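(* Every $(S_1,\dots,S_k;S,W)$-reflection hypergraph $H$ is weakly norming. Moreover, if $\bigcap_{i=1}^k S_i=\emptyset$, then $H$ is norming.
   Context: $W\subset\mathbf{GL}(n,\mathbb{R})$ is a finite reflection group and $S$ its set of simple reflections with respect to a fixed simple system. For $S_1,\dots,S_k\subseteq S$ let $W_i=\langle S_i\rangle$. The $(S_1,\dots,S_k;S,W)$-reflection hypergraph is the $k$-partite $k$-uniform hypergraph whose $i$-th part is the set of left cosets of $W_i$, with an edge $(wW_1,wW_2,\dots,wW_k)$ for every $w\in W$. For a $k$-partite $k$-graph $H$ and bounded measurable $f:[0,1]^k\to\mathbb{R}$, $\|f\|_H:=\left|\int\prod_{(u_1,\dots,u_k)\in E(H)}f(x_{u_1},\dots,x_{u_k})\,d\mu^{|V(H)|}\right|^{1/|E(H)|}$, where $u_i$ lies in the $i$-th part and $\mu$ is Lebesgue measure on $[0,1]$; $H$ is norming if $\|\cdot\|_H$ is a semi-norm, and weakly norming if $f\mapsto\||f|\|_H$ is a norm, on bounded measurable functions $[0,1]^k\to\mathbb{R}$. *)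

theory Defs
  imports "HOL-Analysis.Analysis" "HOL-Algebra.Left_Coset" "HOL-Algebra.Generated_Groups"
begin

section \<open>Finite reflection groups\<close>

definition GL :: "(real ^ 'n ^ 'n) monoid" where
  "GL = \<lparr>carrier = {A. invertible A}, mult = (**), one = mat 1\<rparr>"

text \<open>
  A reflection negates a nonzero vector and fixes a hyperplane pointwise. No inner product is
  singled out, as the ambient group is the full general linear group. If \<open>s\<close> is orthogonal, the
  fixed hyperplane is necessarily the orthogonal complement of \<open>\<alpha>\<close>
  (see \<open>reflection_along_orthogonal\<close> below), so that for subgroups of the orthogonal group the
  following definitions are the usual Euclidean ones.
\<close>

definition reflection_along :: "real ^ 'n \<Rightarrow> real ^ 'n ^ 'n \<Rightarrow> bool" where
  "reflection_along \<alpha> s \<longleftrightarrow>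
     \<alpha> \<noteq> 0 \<and> s *v \<alpha> = - \<alpha> \<and> dim {v. s *v v = v} = CARD('n) - 1"

definition finite_reflection_group :: "(real ^ 'n ^ 'n) set \<Rightarrow> bool" where
  "finite_reflection_group W \<longleftrightarrow>
     subgroup W GL \<and> finite W \<and> W = generate GL {s \<in> W. \<exists>\<alpha>. reflection_along \<alpha> s}"

definition reflections_of :: "(real ^ 'n ^ 'n) set \<Rightarrow> (real ^ 'n) set \<Rightarrow> (real ^ 'n ^ 'n) set" where
  "reflections_of W \<Phi> = {s \<in> W. \<exists>\<alpha>\<in>\<Phi>. reflection_along \<alpha> s}"

definition root_system_of :: "(real ^ 'n ^ 'n) set \<Rightarrow> (real ^ 'n) set \<Rightarrow> bool" where
  "root_system_of W \<Phi> \<longleftrightarrow>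
     finite \<Phi> \<and> 0 \<notin> \<Phi> \<and>
     (\<forall>\<alpha>\<in>\<Phi>. \<Phi> \<inter> span {\<alpha>} = {\<alpha>, - \<alpha>}) \<and>
     (\<forall>w\<in>W. (*v) w ` \<Phi> = \<Phi>) \<and>
     (\<forall>\<alpha>\<in>\<Phi>. \<exists>s\<in>W. reflection_along \<alpha> s) \<and>
     W = generate GL (reflections_of W \<Phi>)"

definition simple_system :: "(real ^ 'n) set \<Rightarrow> (real ^ 'n) set \<Rightarrow> bool" where
  "simple_system \<Phi> \<Delta> \<longleftrightarrow>
     \<Delta> \<subseteq> \<Phi> \<and> independent \<Delta> \<and> span \<Delta> = span \<Phi> \<and>
     (\<forall>\<beta>\<in>\<Phi>. \<exists>c. \<beta> = (\<Sum>\<alpha>\<in>\<Delta>. c \<alpha> *\<^sub>R \<alpha>) \<and>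
        ((\<forall>\<alpha>\<in>\<Delta>. c \<alpha> \<ge> 0) \<or> (\<forall>\<alpha>\<in>\<Delta>. c \<alpha> \<le> 0)))"

lemma reflection_along_orthogonal:
  fixes s :: "real ^ 'n ^ 'n"
  assumes o: "orthogonal_matrix s" and a: "\<alpha> \<noteq> 0"
  shows "reflection_along \<alpha> s \<longleftrightarrow> (\<forall>v. s *v v = v - (2 * (v \<bullet> \<alpha>) / (\<alpha> \<bullet> \<alpha>)) *\<^sub>R \<alpha>)"
proof
  assume r: "reflection_along \<alpha> s"
  let ?F = "{v. s *v v = v}" and ?H = "{v. \<alpha> \<bullet> v = 0}"
  have "orthogonal_transformation ((*v) s)"
    using o orthogonal_transformation_matrix[of "(*v) s"] by simp
  then have inn: "(s *v v) \<bullet> (s *v w) = v \<bullet> w" for v w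
    by (simp add: orthogonal_transformation_def)
  have sa: "s *v \<alpha> = - \<alpha>" using r by (simp add: reflection_along_def)
  have "\<alpha> \<bullet> v = 0" if "s *v v = v" for v
    using inn[of \<alpha> v] that sa by simp
  then have "?F \<subseteq> ?H" by blast
  moreover have "subspace ?F"
    by (auto simp: subspace_def matrix_vector_right_distrib matrix_vector_mult_scaleR)
  moreover have "subspace ?H" by (rule subspace_hyperplane)
  moreover have "dim ?H \<le> dim ?F"
    using r a dim_hyperplane[OF a] by (simp add: reflection_along_def)
  ultimately have FH: "?F = ?H" by (simp add: subspace_dim_equal)
  show "\<forall>v. s *v v = v - (2 * (v \<bullet> \<alpha>) / (\<alpha> \<bullet> \<alpha>)) *\<^sub>R \<alpha>"
  proof
    fix v
    let ?c = "(v \<bullet> \<alpha>) / (\<alpha> \<bullet> \<alpha>)"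
    have "v - ?c *\<^sub>R \<alpha> \<in> ?H" using a by (simp add: inner_diff_right inner_commute)
    then have "s *v (v - ?c *\<^sub>R \<alpha>) = v - ?c *\<^sub>R \<alpha>" using FH by blast
    then have "s *v v = v - ?c *\<^sub>R \<alpha> - ?c *\<^sub>R \<alpha>"
      by (simp add: matrix_vector_mult_diff_distrib matrix_vector_mult_scaleR sa algebra_simps)
    then show "s *v v = v - (2 * (v \<bullet> \<alpha>) / (\<alpha> \<bullet> \<alpha>)) *\<^sub>R \<alpha>"
      by (simp add: diff_diff_eq flip: scaleR_add_left)
  qed
next
  assume f: "\<forall>v. s *v v = v - (2 * (v \<bullet> \<alpha>) / (\<alpha> \<bullet> \<alpha>)) *\<^sub>R \<alpha>"
  then have "{v. s *v v = v} = {v. \<alpha> \<bullet> v = 0}" using a by (auto simp: inner_commute)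
  moreover have "s *v \<alpha> = - \<alpha>" using f a by (simp add: scaleR_2)
  ultimately show "reflection_along \<alpha> s"
    using a dim_hyperplane[OF a] by (simp add: reflection_along_def)
qed

section \<open>Hypergraph norms\<close>

text \<open>
  The parts of a \<open>k\<close>-partite \<open>k\<close>-graph are indexed by a finite type \<open>'k\<close>, and an edge is the
  function that picks its vertex in each part. A vertex is tagged with its part, so that the
  parts are disjoint even if, as sets, they are not.
\<close>

record ('k, 'v) kgraph =
  part :: "'k \<Rightarrow> 'v set"
  edges :: "('k \<Rightarrow> 'v) set"

definition vertices :: "('k, 'v) kgraph \<Rightarrow> ('k \<times> 'v) set" where
  "vertices H = (SIGMA i:UNIV. part H i)"

abbreviation cube :: "(real ^ 'k) set" where
  "cube \<equiv> {0..1}"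

text \<open>
  Only the values of \<open>f\<close> on the unit cube matter. The product measure is completed because
  \<open>f\<close> is only assumed Lebesgue measurable.
\<close>

definition bounded_measurable :: "(real ^ 'k \<Rightarrow> real) set" where
  "bounded_measurable = {f \<in> borel_measurable (lebesgue_on cube). bounded (f ` cube)}"

definition hom_integral :: "('k::finite, 'v) kgraph \<Rightarrow> (real ^ 'k \<Rightarrow> real) \<Rightarrow> real" where
  "hom_integral H f =
     (\<integral>x. (\<Prod>e\<in>edges H. f (\<chi> i. x (i, e i)))
        \<partial>completion (\<Pi>\<^sub>M u\<in>vertices H. lebesgue_on {0..1::real}))"

definition kgraph_norm :: "('k::finite, 'v) kgraph \<Rightarrow> (real ^ 'k \<Rightarrow> real) \<Rightarrow> real" where
  "kgraph_norm H f = \<bar>hom_integral H f\<bar> powr (1 / card (edges H))"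

definition is_seminorm :: "((real ^ 'k \<Rightarrow> real) \<Rightarrow> real) \<Rightarrow> bool" where
  "is_seminorm p \<longleftrightarrow>
     (\<forall>f\<in>bounded_measurable. p f \<ge> 0) \<and>
     (\<forall>f\<in>bounded_measurable. \<forall>c. p (\<lambda>x. c * f x) = \<bar>c\<bar> * p f) \<and>
     (\<forall>f\<in>bounded_measurable. \<forall>g\<in>bounded_measurable. p (\<lambda>x. f x + g x) \<le> p f + p g)"

text \<open>As usual, functions that agree almost everywhere on the cube are identified.\<close>

definition is_norm :: "((real ^ 'k \<Rightarrow> real) \<Rightarrow> real) \<Rightarrow> bool" where
  "is_norm p \<longleftrightarrow> is_seminorm p \<and>
     (\<forall>f\<in>bounded_measurable. p f = 0 \<longleftrightarrow> (AE x in lebesgue_on cube. f x = 0))"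

definition norming :: "('k::finite, 'v) kgraph \<Rightarrow> bool" where
  "norming H \<longleftrightarrow> is_seminorm (kgraph_norm H)"

definition weakly_norming :: "('k::finite, 'v) kgraph \<Rightarrow> bool" where
  "weakly_norming H \<longleftrightarrow> is_norm (\<lambda>f. kgraph_norm H (\<lambda>x. \<bar>f x\<bar>))"

section \<open>Reflection hypergraphs\<close>

definition reflection_hypergraph ::
    "('k \<Rightarrow> (real ^ 'n ^ 'n) set) \<Rightarrow> (real ^ 'n ^ 'n) set \<Rightarrow> ('k, (real ^ 'n ^ 'n) set) kgraph" where
  "reflection_hypergraph T W =
     \<lparr>part = (\<lambda>i. lcosets\<^bsub>GL\<lparr>carrier := W\<rparr>\<^esub> (generate GL (T i))),
      edges = {\<lambda>i. w <#\<^bsub>GL\<^esub> generate GL (T i) | w. w \<in> W}\<rparr>"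

lemma reflection_hypergraph_edge_in_part:
  "e \<in> edges (reflection_hypergraph T W) \<Longrightarrow> e i \<in> part (reflection_hypergraph T W) i"
  by (auto simp: reflection_hypergraph_def LCOSETS_def l_coset_def)

end

theory Submission
  imports Defs "HOL-Probability.Infinite_Product_Measure"
begin

text \<open>
  Colour the edges of \<open>H\<close> by functions and replace every factor of the integral by the function of
  its colour. A simple reflection fixes the vertices of \<open>H\<close> (cosets) that meet both sides of its
  wall and exchanges those on the two sides, and no edge joins the two sides. Integrating over the
  fixed vertices last, the integral becomes a positive semidefinite pairing of the two sides; hence
  \<open>2\<bar>I c\<bar> \<le> I c' + I c''\<close>, where \<open>c'\<close> and \<open>c''\<close> copy the colours of one side to the other. The
  factors on edges inside the fixed set must be nonnegative for this; there are no such edges if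
  \<open>\<Inter>S\<^sub>i = \<emptyset>\<close>, because the root of a reflection in every conjugate \<open>wW\<^sub>iw\<inverse>\<close> would be spanned by
  \<open>w\<close> applied to simple roots common to all \<open>S\<^sub>i\<close>.

  Consequently a colouring that maximises \<open>\<bar>I c\<bar>\<close> stays maximal under folding. Folding towards the
  fundamental chamber never increases the length, so a composition of such folds turns it into a
  constant colouring. This gives \<open>\<bar>I c\<bar> \<le> 1\<close> whenever all colours have norm at most 1, and the
  triangle inequality follows by expanding \<open>\<Prod>(f + g)\<close>.
\<close>

section \<open>Product measures\<close>

text \<open>Expanding \<open>\<Prod>(f + g)\<close> mixes only two functions, so the colourings in
  question form a finite set and a maximiser exists without any compactness argument. An arithmetic
  mean on the right of the folding inequality is then enough: neither fold exceeds the maximum, so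
  both attain it. Definiteness of the weak norm comes from the same colour bound, applied to a
  colouring with one distinguished edge. Composing a Lebesgue measurable function with an edge map
  may destroy measurability on the uncompleted product; functions are therefore exchanged for
  bounded Borel representatives, and all colours are Borel. The group need not be orthogonal, so
  angles are measured by an inner product averaged over \<open>W\<close>. That a coset meeting both
  sides of a wall is fixed by the reflection rests on the subgroups being generated by simple
  reflections: the exchange condition, applied to a word in these generators, puts a conjugate of
  the reflection into the subgroup.\<close>

abbreviation unit_measure :: "real measure" where
  "unit_measure \<equiv> lebesgue_on {0..1}"

abbreviation unit_product :: "'i set \<Rightarrow> ('i \<Rightarrow> real) measure" where
  "unit_product I \<equiv> \<Pi>\<^sub>M i\<in>I. unit_measure"

lemma prob_space_unit_measure: "prob_space unit_measure"
  by (rule prob_spaceI) (simp add: space_restrict_space emeasure_restrict_space)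

lemma product_sigma_finite_unit: "product_sigma_finite (\<lambda>_. unit_measure)"
  using prob_space_unit_measure by (simp add: product_sigma_finite_def prob_space_imp_sigma_finite)

lemma product_prob_space_unit: "product_prob_space (\<lambda>_. unit_measure)"
  using prob_space_unit_measure product_sigma_finite_unit
  by (simp add: product_prob_space_def product_prob_space_axioms_def)

lemma prob_space_unit_product: "prob_space (unit_product I)"
  by (intro prob_space_PiM prob_space_unit_measure)

lemma integrable_unit_product:
  fixes f :: "('i \<Rightarrow> real) \<Rightarrow> real"
  assumes "f \<in> borel_measurable (unit_product I)" "\<And>x. \<bar>f x\<bar> \<le> B"
  shows "integrable (unit_product I) f"
proof -
  interpret prob_space "unit_product I" by (rule prob_space_unit_product)
  show ?thesis using assms by (intro integrable_const_bound[where B = B]) auto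
qed

lemma id_borel_measurable_unit: "(\<lambda>x. x) \<in> borel_measurable unit_measure"
  by (intro measurable_restrict_space1 measurable_completion) simp

lemma measurable_coordinate [measurable]: "i \<in> I \<Longrightarrow> (\<lambda>x. x i) \<in> borel_measurable (unit_product I)"
  by (rule measurable_compose[OF measurable_component_singleton[where M = "\<lambda>_. unit_measure"] id_borel_measurable_unit])

lemma measurable_edge:
  fixes e :: "'k::finite \<Rightarrow> 'v"
  assumes "\<And>i. (i, e i) \<in> I"
  shows "(\<lambda>x. \<chi> i. x (i, e i)) \<in> borel_measurable (unit_product I)"
  unfolding borel_measurable_euclidean_space[where 'c = "real ^ 'k"]
proof
  fix b :: "real ^ 'k" assume "b \<in> Basis"
  then obtain i where b: "b = axis i 1" by (auto simp: Basis_vec_def)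
  have "(\<lambda>x. (\<chi> i. x (i, e i)) \<bullet> b) = (\<lambda>x :: 'k \<times> 'v \<Rightarrow> real. x (i, e i))"
    by (simp add: b inner_axis)
  then show "(\<lambda>x. (\<chi> i. x (i, e i)) \<bullet> b) \<in> borel_measurable (unit_product I)"
    using measurable_coordinate[OF assms] by metis
qed

section \<open>Reflection positivity\<close>

text \<open>For fixed coordinates in \<open>F\<close> the integrand splits into the same function of the coordinates
  in \<open>L\<close> and of those in \<open>R\<close>, so that the inner integral is a square.\<close>

lemma reflection_positivity:
  fixes p u :: "('i \<Rightarrow> real) \<Rightarrow> real"
  assumes fin: "finite F" "finite L" "finite R"
    and disj: "F \<inter> L = {}" "F \<inter> R = {}" "L \<inter> R = {}"
    and \<sigma>: "bij_betw \<sigma> L R" "\<And>i. i \<in> F \<Longrightarrow> \<sigma> i = i"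
    and p_dep: "\<And>x y. (\<And>i. i \<in> F \<Longrightarrow> x i = y i) \<Longrightarrow> p x = p y"
    and u_dep: "\<And>x y. (\<And>i. i \<in> F \<union> L \<Longrightarrow> x i = y i) \<Longrightarrow> u x = u y"
    and p_nonneg: "\<And>x. x \<in> space (unit_product F) \<Longrightarrow> 0 \<le> p x"
    and u_meas: "u \<in> borel_measurable (unit_product (F \<union> L))"
    and meas [measurable]: "p \<in> borel_measurable (unit_product (F \<union> (L \<union> R)))"
      "u \<in> borel_measurable (unit_product (F \<union> (L \<union> R)))"
      "(\<lambda>x. u (\<lambda>i. x (\<sigma> i))) \<in> borel_measurable (unit_product (F \<union> (L \<union> R)))"
    and bound: "\<And>x. \<bar>p x * (u x * u (\<lambda>i. x (\<sigma> i)))\<bar> \<le> B" "\<And>x. \<bar>u x\<bar> \<le> K"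
  shows "0 \<le> (\<integral>x. p x * (u x * u (\<lambda>i. x (\<sigma> i))) \<partial>unit_product (F \<union> (L \<union> R)))"
proof -
  interpret product_sigma_finite "\<lambda>_::'i. unit_measure"
    by (rule product_sigma_finite_unit)
  let ?h = "\<lambda>x. p x * (u x * u (\<lambda>i. x (\<sigma> i)))"
  have "(\<integral>x. ?h x \<partial>unit_product (F \<union> (L \<union> R)))
      = (\<integral>x. \<integral>z. ?h (merge F (L \<union> R) (x, z)) \<partial>unit_product (L \<union> R) \<partial>unit_product F)"
    using fin disj bound(1)
    by (intro product_integral_fold integrable_unit_product borel_measurable_times meas) auto
  also have "\<dots> = (\<integral>x. p x * (\<integral>y. u (merge F L (x, y)) \<partial>unit_product L)\<^sup>2 \<partial>unit_product F)"
  proof (rule Bochner_Integration.integral_cong[OF refl])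
    fix x assume x: "x \<in> space (unit_product F)"
    let ?U = "\<lambda>y. u (merge F L (x, y))"
    let ?g = "\<lambda>z. u (merge F (L \<union> R) (x, z)) * u (\<lambda>i. merge F (L \<union> R) (x, z) (\<sigma> i))"
    have U_meas: "?U \<in> borel_measurable (unit_product L)"
      using x by (intro measurable_compose[OF _ u_meas] measurable_compose[OF _ measurable_merge]) simp_all
    have U1: "u (merge F (L \<union> R) (x, merge L R (y, y'))) = ?U y" for y y'
      by (rule u_dep) (use disj in \<open>auto simp: merge_def\<close>)
    \<comment> \<open>On \<open>F\<close> the map \<sigma> is the identity and on \<open>L\<close>
      it lands in \<open>R\<close>, so the reflected factor reads only the fixed coordinates and
      \<open>y'\<close>: it is the same section \<open>?U\<close>.\<close>
    have U2: "u (\<lambda>i. merge F (L \<union> R) (x, merge L R (y, y')) (\<sigma> i)) = ?U (\<lambda>i\<in>L. y' (\<sigma> i))" for y y'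
    proof (rule u_dep)
      fix i assume i: "i \<in> F \<union> L"
      show "merge F (L \<union> R) (x, merge L R (y, y')) (\<sigma> i) = merge F L (x, \<lambda>i\<in>L. y' (\<sigma> i)) i"
      proof (cases "i \<in> F")
        case True
        then show ?thesis using \<sigma>(2) by (simp add: merge_def)
      next
        case False
        then have "i \<in> L" "\<sigma> i \<in> R" using i bij_betwE[OF \<sigma>(1)] by auto
        then show ?thesis using False disj by (auto simp: merge_def)
      qed
    qed
    have restr: "(\<lambda>y'. \<lambda>i\<in>L. y' (\<sigma> i)) \<in> unit_product R \<rightarrow>\<^sub>M unit_product L"
      using bij_betwE[OF \<sigma>(1)] by (intro measurable_restrict measurable_component_singleton) auto
    \<comment> \<open>Renaming coordinates along a bijection carries one power of the unit measure
      to the other, so both factors have the same integral over their own side; this produces the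
      square.\<close>
    have "distr (unit_product R) (unit_product L) (\<lambda>y'. \<lambda>i\<in>L. y' (\<sigma> i)) = unit_product L"
      using \<sigma>(1) prob_space_unit_measure
      by (intro distr_PiM_reindex[where M = "\<lambda>_. unit_measure"]) (auto simp: bij_betw_def)
    then have R: "(\<integral>y'. ?U (\<lambda>i\<in>L. y' (\<sigma> i)) \<partial>unit_product R) = (\<integral>y. ?U y \<partial>unit_product L)"
      using integral_distr[OF restr U_meas] by simp
    have "?g \<in> borel_measurable (unit_product (L \<union> R))"
      by (rule measurable_compose[OF _ borel_measurable_times[OF meas(2,3)]],
          rule measurable_compose[OF _ measurable_merge]) (use x in simp)
    moreover have "\<bar>?g z\<bar> \<le> K * K" for z
      unfolding abs_mult by (rule mult_mono[OF bound(2) bound(2) order_trans[OF abs_ge_zero bound(2)] abs_ge_zero])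
    ultimately have "(\<integral>z. ?g z \<partial>unit_product (L \<union> R))
        = (\<integral>y. \<integral>y'. ?g (merge L R (y, y')) \<partial>unit_product R \<partial>unit_product L)"
      using disj(3) fin(2,3) by (intro product_integral_fold integrable_unit_product[where B = "K * K"])
    also have "\<dots> = (\<integral>y. ?U y \<partial>unit_product L)\<^sup>2"
      by (simp only: U1 U2 R integral_mult_right_zero integral_mult_left_zero power2_eq_square)
    finally have "(\<integral>z. ?g z \<partial>unit_product (L \<union> R)) = (\<integral>y. ?U y \<partial>unit_product L)\<^sup>2" .
    moreover have "p (merge F (L \<union> R) (x, z)) = p x" for z
      by (rule p_dep) (simp add: merge_def)
    ultimately show "(\<integral>z. ?h (merge F (L \<union> R) (x, z)) \<partial>unit_product (L \<union> R))
        = p x * (\<integral>y. ?U y \<partial>unit_product L)\<^sup>2"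
      by (simp only: integral_mult_right_zero)
  qed
  also have "\<dots> \<ge> 0"
    using p_nonneg by (intro Bochner_Integration.integral_nonneg) auto
  finally show ?thesis .
qed

text \<open>Cauchy-Schwarz for the pairing \<open>I\<close> in its arithmetic mean version:
  \<open>I\<close> is nonnegative on the diagonal at u + v and at u - v, and the mixed terms merge
  because \<open>I\<close> is symmetric, permuting the coordinates by \<sigma> being measure
  preserving.\<close>

lemma reflection_inequality:
  fixes p u v :: "('i \<Rightarrow> real) \<Rightarrow> real"
  assumes fin: "finite F" "finite L" "finite R"
    and disj: "F \<inter> L = {}" "F \<inter> R = {}" "L \<inter> R = {}"
    and \<sigma>: "\<sigma> ` L \<subseteq> R" "\<sigma> ` R \<subseteq> L" "\<And>i. i \<in> F \<Longrightarrow> \<sigma> i = i" "\<And>i. i \<in> L \<union> R \<Longrightarrow> \<sigma> (\<sigma> i) = i"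
    and p_dep: "\<And>x y. (\<And>i. i \<in> F \<Longrightarrow> x i = y i) \<Longrightarrow> p x = p y"
    and u_dep: "\<And>x y. (\<And>i. i \<in> F \<union> L \<Longrightarrow> x i = y i) \<Longrightarrow> u x = u y"
    and v_dep: "\<And>x y. (\<And>i. i \<in> F \<union> L \<Longrightarrow> x i = y i) \<Longrightarrow> v x = v y"
    and p_nonneg: "\<And>x. x \<in> space (unit_product F) \<Longrightarrow> 0 \<le> p x"
    and meas_FL: "u \<in> borel_measurable (unit_product (F \<union> L))" "v \<in> borel_measurable (unit_product (F \<union> L))"
    and meas: "p \<in> borel_measurable (unit_product (F \<union> (L \<union> R)))"
      "u \<in> borel_measurable (unit_product (F \<union> (L \<union> R)))"
      "v \<in> borel_measurable (unit_product (F \<union> (L \<union> R)))"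
    and bound: "\<And>x. \<bar>p x\<bar> \<le> B" "\<And>x. \<bar>u x\<bar> \<le> B" "\<And>x. \<bar>v x\<bar> \<le> B"
  defines "I \<equiv> \<lambda>f g. \<integral>x. p x * (f x * g (\<lambda>i. x (\<sigma> i))) \<partial>unit_product (F \<union> (L \<union> R))"
  shows "\<bar>I u v\<bar> \<le> (I u u + I v v) / 2"
proof -
  let ?V = "F \<union> (L \<union> R)" and ?t = "\<lambda>x. \<lambda>i\<in>F \<union> (L \<union> R). x (\<sigma> i)"
  have inv: "\<sigma> (\<sigma> i) = i" "\<sigma> i \<in> ?V" if "i \<in> ?V" for i
    using that \<sigma> by auto
  have \<sigma>_bij: "bij_betw \<sigma> L R"
    using \<sigma> by (intro bij_betw_byWitness[where f' = \<sigma>]) auto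
  have t_meas: "?t \<in> unit_product ?V \<rightarrow>\<^sub>M unit_product ?V"
    using inv(2) by (intro measurable_restrict measurable_component_singleton) auto
  have t_distr: "distr (unit_product ?V) (unit_product ?V) ?t = unit_product ?V"
    using inv prob_space_unit_measure
    by (intro distr_PiM_reindex[where M = "\<lambda>_. unit_measure"]) (auto simp only: Pi_iff intro: inj_on_inverseI)
  \<comment> \<open>Points of the product space are extensional, which
    \<open>\<lambda>i. x (\<sigma> i)\<close> need not be. Since f reads only
    \<open>F \<union> L\<close>, it may be replaced by the restricted map \<open>?t\<close>.\<close>
  have \<sigma>_meas: "(\<lambda>x. f (\<lambda>i. x (\<sigma> i))) \<in> borel_measurable (unit_product ?V)"
    if "f \<in> borel_measurable (unit_product ?V)"
      "\<And>x y. (\<And>i. i \<in> F \<union> L \<Longrightarrow> x i = y i) \<Longrightarrow> f x = f y" for f :: "('i \<Rightarrow> real) \<Rightarrow> real"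
  proof -
    have "(\<lambda>x. f (\<lambda>i. x (\<sigma> i))) = (\<lambda>x. f (?t x))"
      by (rule ext, rule that(2)) auto
    then show ?thesis using measurable_compose[OF t_meas that(1)] by (simp only:)
  qed
  note u_meas = \<sigma>_meas[OF meas(2) u_dep] and v_meas = \<sigma>_meas[OF meas(3) v_dep]
  have B: "0 \<le> B" using order_trans[OF abs_ge_zero bound(1)] .
  have B3: "\<bar>p x * (f x * g (\<lambda>i. x (\<sigma> i)))\<bar> \<le> B * (B' * B')"
    if "\<And>x. \<bar>f x\<bar> \<le> B'" "\<And>x. \<bar>g x\<bar> \<le> B'" for f g B' x
    unfolding abs_mult
    by (intro mult_mono that bound(1) B mult_nonneg_nonneg abs_ge_zero order_trans[OF abs_ge_zero that(1)])
  have int: "integrable (unit_product ?V) (\<lambda>x. p x * (f x * g (\<lambda>i. x (\<sigma> i))))"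
    if "f = u \<or> f = v" "g = u \<or> g = v" for f g
  proof (rule integrable_unit_product)
    show "\<bar>p x * (f x * g (\<lambda>i. x (\<sigma> i)))\<bar> \<le> B * (B * B)" for x
      using that bound(2,3) by (intro B3) metis+
    have "f \<in> borel_measurable (unit_product ?V)" using that(1) meas(2,3) by metis
    moreover have "(\<lambda>x. g (\<lambda>i. x (\<sigma> i))) \<in> borel_measurable (unit_product ?V)"
      using that(2) u_meas v_meas by metis
    ultimately show "(\<lambda>x. p x * (f x * g (\<lambda>i. x (\<sigma> i)))) \<in> borel_measurable (unit_product ?V)"
      by (intro borel_measurable_times meas(1))
  qed
  have sym: "I v u = I u v"
  proof -
    have "I v u = (\<integral>x. p x * (v x * u (\<lambda>i. x (\<sigma> i))) \<partial>distr (unit_product ?V) (unit_product ?V) ?t)"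
      by (simp only: t_distr I_def)
    also have "\<dots> = (\<integral>x. p (?t x) * (v (?t x) * u (\<lambda>i. ?t x (\<sigma> i))) \<partial>unit_product ?V)"
      by (rule integral_distr[OF t_meas borel_measurable_times[OF meas(1) borel_measurable_times[OF meas(3) u_meas]]])
    also have "\<dots> = I u v"
      unfolding I_def
    proof (rule Bochner_Integration.integral_cong[OF refl])
      fix x
      have "p (?t x) = p x" by (rule p_dep) (simp add: \<sigma>(3))
      moreover have "v (?t x) = v (\<lambda>i. x (\<sigma> i))" by (rule v_dep) auto
      moreover have "u (\<lambda>i. ?t x (\<sigma> i)) = u x"
      proof (rule u_dep)
        fix i assume "i \<in> F \<union> L"
        then have "i \<in> ?V" by blast
        from inv[OF this] show "?t x (\<sigma> i) = x i" by (simp only: restrict_apply if_True)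
      qed
      ultimately show "p (?t x) * (v (?t x) * u (\<lambda>i. ?t x (\<sigma> i))) = p x * (u x * v (\<lambda>i. x (\<sigma> i)))"
        by (simp only: mult.commute)
    qed
    finally show ?thesis .
  qed
  \<comment> \<open>The two values of c give an upper bound for \<open>I u v\<close> and for its
    negative, hence for the absolute value.\<close>
  have pos: "0 \<le> I u u + I v v + 2 * c * I u v" if c: "c = 1 \<or> c = -1" for c :: real
  proof -
    let ?w = "\<lambda>x. u x + c * v x"
    have wB: "\<bar>?w x\<bar> \<le> 2 * B" for x
      using bound(2)[of x] bound(3)[of x] c by (elim disjE; hypsubst; linarith)
    have "0 \<le> I ?w ?w"
      unfolding I_def
    proof (rule reflection_positivity[where p = p and u = ?w and \<sigma> = \<sigma> and K = "2 * B"
          and B = "B * (2 * B * (2 * B))"])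
      show "?w x = ?w y" if "\<And>i. i \<in> F \<union> L \<Longrightarrow> x i = y i" for x y
      proof -
        have "u x = u y" by (rule u_dep) (rule that)
        moreover have "v x = v y" by (rule v_dep) (rule that)
        ultimately show ?thesis by (simp only:)
      qed
      show "?w \<in> borel_measurable (unit_product (F \<union> L))"
        by (rule borel_measurable_add[OF meas_FL(1) borel_measurable_times[OF borel_measurable_const meas_FL(2)]])
      show "?w \<in> borel_measurable (unit_product ?V)"
        by (rule borel_measurable_add[OF meas(2) borel_measurable_times[OF borel_measurable_const meas(3)]])
      show "(\<lambda>x. u (\<lambda>i. x (\<sigma> i)) + c * v (\<lambda>i. x (\<sigma> i))) \<in> borel_measurable (unit_product ?V)"
        by (rule borel_measurable_add[OF u_meas borel_measurable_times[OF borel_measurable_const v_meas]])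
      show "\<bar>p x * (?w x * (u (\<lambda>i. x (\<sigma> i)) + c * v (\<lambda>i. x (\<sigma> i))))\<bar> \<le> B * (2 * B * (2 * B))" for x
        by (rule B3[of ?w "2 * B" ?w x, OF wB wB])
    qed (fact fin disj \<sigma>_bij \<sigma>(3) p_dep p_nonneg meas(1) wB)+
    also have "I ?w ?w = I u u + c * I u v + (c * I v u + c * c * I v v)"
    proof -
      let ?J = "\<lambda>f g x. p x * (f x * g (\<lambda>i. x (\<sigma> i)))"
      have "?J ?w ?w = (\<lambda>x. (?J u u x + c * ?J u v x) + (c * ?J v u x + c * c * ?J v v x))"
        by (rule ext) (simp only: algebra_simps)
      moreover have i: "integrable (unit_product ?V) (?J u u)" "integrable (unit_product ?V) (\<lambda>x. c * ?J u v x)"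
        "integrable (unit_product ?V) (\<lambda>x. c * ?J v u x)" "integrable (unit_product ?V) (\<lambda>x. c * c * ?J v v x)"
        by (intro integrable_mult_right int; blast)+
      ultimately show ?thesis
        unfolding I_def
        by (simp only: Bochner_Integration.integral_add[OF Bochner_Integration.integrable_add[OF i(1,2)] Bochner_Integration.integrable_add[OF i(3,4)]]
            Bochner_Integration.integral_add[OF i(1,2)] Bochner_Integration.integral_add[OF i(3,4)]
            integral_mult_right_zero)
    qed
    finally show ?thesis using c unfolding sym by (elim disjE; hypsubst; linarith)
  qed
  have "0 \<le> I u u + I v v + 2 * I u v" using pos[OF disjI1[OF refl]] by (simp only: mult_1_right)
  moreover have "0 \<le> I u u + I v v - 2 * I u v" using pos[OF disjI2[OF refl]] by simp
  ultimately show ?thesis unfolding abs_le_iff by (simp only: le_divide_eq_numeral1 minus_le_iff) linarith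
qed

section \<open>Coloured integrals\<close>

text \<open>The constant colouring recovers the integral behind the norm. The product stays
  uncompleted because the colours will be Borel functions.\<close>

definition colored_integral ::
    "('k::finite, 'v) kgraph \<Rightarrow> (('k \<Rightarrow> 'v) \<Rightarrow> real ^ 'k \<Rightarrow> real) \<Rightarrow> real" where
  "colored_integral H c =
     (\<integral>x. (\<Prod>e\<in>edges H. c e (\<chi> i. x (i, e i))) \<partial>unit_product (vertices H))"

text \<open>Measurability and bound are imposed on the whole space instead of the cube, so that
  integrands are bounded at every assignment of the vertices.\<close>

definition bounded_borel :: "(real ^ 'k \<Rightarrow> real) set" where
  "bounded_borel = {g \<in> borel_measurable borel. \<exists>B. \<forall>x. \<bar>g x\<bar> \<le> B}"

lemma measurable_edge_prod:
  fixes c :: "('k::finite \<Rightarrow> 'v) \<Rightarrow> real ^ 'k \<Rightarrow> real"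
  assumes "\<And>e. e \<in> A \<Longrightarrow> c e \<in> bounded_borel" "\<And>e i. e \<in> A \<Longrightarrow> (i, e i) \<in> I"
  shows "(\<lambda>x. \<Prod>e\<in>A. c e (\<chi> i. x (i, e i))) \<in> borel_measurable (unit_product I)"
proof (rule borel_measurable_prod)
  fix e assume e: "e \<in> A"
  then have "c e \<in> borel_measurable borel" using assms(1) by (simp add: bounded_borel_def)
  moreover have "(\<lambda>x. \<chi> i. x (i, e i)) \<in> borel_measurable (unit_product I)"
    using assms(2)[OF e] by (rule measurable_edge)
  ultimately show "(\<lambda>x. c e (\<chi> i. x (i, e i))) \<in> borel_measurable (unit_product I)"
    by (rule measurable_compose[rotated])
qed

lemma bounded_edge_prod:
  fixes c :: "('k::finite \<Rightarrow> 'v) \<Rightarrow> real ^ 'k \<Rightarrow> real"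
  assumes fin: "finite A" and c: "\<And>e. e \<in> A \<Longrightarrow> c e \<in> bounded_borel"
  obtains B where "\<And>x. \<bar>\<Prod>e\<in>A. c e (\<chi> i. x (i, e i))\<bar> \<le> B"
proof -
  have "\<forall>e\<in>A. \<exists>B. \<forall>x. \<bar>c e x\<bar> \<le> B" using c by (auto simp: bounded_borel_def)
  then obtain b where b: "\<And>e x. e \<in> A \<Longrightarrow> \<bar>c e x\<bar> \<le> b e" by metis
  have "\<bar>\<Prod>e\<in>A. c e (\<chi> i. x (i, e i))\<bar> \<le> (\<Prod>e\<in>A. b e)" for x
    unfolding abs_prod using b by (intro prod_mono) auto
  then show thesis by (rule that)
qed

section \<open>Folding a hypergraph across one wall\<close>

locale folded_kgraph =
  fixes H :: "('k::finite, 'v) kgraph" and \<tau> :: "'v \<Rightarrow> 'v" and L :: "'v set"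
  assumes finite_vertices: "finite (vertices H)" and finite_edges: "finite (edges H)"
    and edge_part: "\<And>e i. e \<in> edges H \<Longrightarrow> e i \<in> part H i"
    and part_closed: "\<And>i v. v \<in> part H i \<Longrightarrow> \<tau> v \<in> part H i"
    and involution: "\<And>i v. v \<in> part H i \<Longrightarrow> \<tau> (\<tau> v) = v"
    and edges_closed: "\<And>e. e \<in> edges H \<Longrightarrow> \<tau> \<circ> e \<in> edges H"
    and fixed: "\<And>i v. v \<in> part H i \<Longrightarrow> v \<notin> L \<Longrightarrow> \<tau> v \<notin> L \<Longrightarrow> \<tau> v = v"
    and cut_part: "\<And>i v. v \<in> part H i \<Longrightarrow> v \<in> L \<Longrightarrow> \<tau> v \<notin> L"
    and cut: "\<And>e i j. e \<in> edges H \<Longrightarrow> e i \<in> L \<Longrightarrow> \<tau> (e j) \<notin> L"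
begin

text \<open>\<open>L\<close> is one side of the wall; the other side consists of the v with
  \<open>\<tau> v\<close> in \<open>L\<close>. An edge touching the other side goes to its mirror
  image, so \<open>c (fold_left e)\<close> is c with the colours of the side \<open>L\<close> copied
  across.\<close>

definition fold_left :: "('k \<Rightarrow> 'v) \<Rightarrow> ('k \<Rightarrow> 'v)" where
  "fold_left e = (if \<exists>i. \<tau> (e i) \<in> L then \<tau> \<circ> e else e)"

definition fold_right :: "('k \<Rightarrow> 'v) \<Rightarrow> ('k \<Rightarrow> 'v)" where
  "fold_right e = (if \<exists>i. e i \<in> L then \<tau> \<circ> e else e)"

lemma involution_edge: "e \<in> edges H \<Longrightarrow> \<tau> \<circ> (\<tau> \<circ> e) = e"
proof (rule ext)
  fix i assume "e \<in> edges H"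
  then show "(\<tau> \<circ> (\<tau> \<circ> e)) i = e i" using involution[OF edge_part] by simp
qed

text \<open>By \<open>cut\<close>, an edge touching \<open>L\<close> lies in
  \<open>VF \<union> VL\<close>. The product over these edges is a function u of those coordinates,
  and the product over the mirror edges is a function v of the same coordinates read through
  \<sigma>. So c gives the pairing of u with v, and its two folds pair u with u and v with
  v.\<close>

lemma fold_inequality:
  assumes c: "\<And>e. e \<in> edges H \<Longrightarrow> c e \<in> bounded_borel"
    and middle: "(\<forall>e\<in>edges H. \<forall>x. 0 \<le> c e x) \<or> (\<forall>e\<in>edges H. \<exists>i. \<tau> (e i) \<noteq> e i)"
  shows "\<bar>colored_integral H c\<bar> \<le>
    (colored_integral H (\<lambda>e. c (fold_left e)) + colored_integral H (\<lambda>e. c (fold_right e))) / 2"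
proof -
  let ?V = "vertices H" and ?E = "edges H"
  define VL where "VL = {(i, v). v \<in> part H i \<and> v \<in> L}"
  define VR where "VR = {(i, v). v \<in> part H i \<and> \<tau> v \<in> L}"
  define VF where "VF = {(i, v). v \<in> part H i \<and> v \<notin> L \<and> \<tau> v \<notin> L}"
  define \<sigma> where "\<sigma> = (\<lambda>(i :: 'k, v). (i, \<tau> v))"
  define EL where "EL = {e \<in> ?E. \<exists>i. e i \<in> L}"
  define ER where "ER = {e \<in> ?E. \<exists>i. \<tau> (e i) \<in> L}"
  define EF where "EF = {e \<in> ?E. \<forall>i. e i \<notin> L \<and> \<tau> (e i) \<notin> L}"
  define P where "P A d x = (\<Prod>e\<in>A. d e (\<chi> i. x (i, e i)))"
    for A :: "('k \<Rightarrow> 'v) set" and d :: "('k \<Rightarrow> 'v) \<Rightarrow> real ^ 'k \<Rightarrow> real" and x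
  note defs = VL_def VR_def VF_def \<sigma>_def EL_def ER_def EF_def
  have V: "?V = VF \<union> (VL \<union> VR)" by (auto simp: vertices_def defs)
  have E: "?E = EF \<union> (EL \<union> ER)" by (auto simp: defs)
  have finE: "finite EF" "finite EL" "finite ER" using finite_edges by (auto simp: defs)
  have disjE: "EF \<inter> (EL \<union> ER) = {}" "EL \<inter> ER = {}" using cut by (auto simp: defs)
  have finV: "finite VF" "finite VL" "finite VR" using finite_vertices V by auto
  have disjV: "VF \<inter> VL = {}" "VF \<inter> VR = {}" by (auto simp: defs)
  have disjVLR: "VL \<inter> VR = {}" using cut_part by (auto simp: defs)
  have swap: "\<tau> \<circ> e \<in> ER" "\<tau> \<circ> (\<tau> \<circ> e) = e" if "e \<in> EL" for e
    using that edges_closed involution_edge[of e] by (auto simp: defs fun_eq_iff)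
  have swap': "\<tau> \<circ> e \<in> EL" "\<tau> \<circ> (\<tau> \<circ> e) = e" if "e \<in> ER" for e
    using that edges_closed involution_edge[of e] by (auto simp: defs fun_eq_iff)
  have P_reflect: "P EL d (\<lambda>i. x (\<sigma> i)) = P ER (\<lambda>e. d (\<tau> \<circ> e)) x" for d x
    unfolding P_def
    by (rule prod.reindex_bij_witness[where i = "\<lambda>e. \<tau> \<circ> e" and j = "\<lambda>e. \<tau> \<circ> e"])
       (use swap swap' in \<open>auto simp: \<sigma>_def\<close>)
  have split: "colored_integral H d = (\<integral>x. P EF d x * (P EL d x * P ER d x) \<partial>unit_product (VF \<union> (VL \<union> VR)))" for d
    unfolding colored_integral_def V E P_def
    using finE disjE by (simp add: prod.union_disjoint)
  \<comment> \<open>Brings the colours of the other side over to \<open>EL\<close>, so that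
    \<open>P EL d\<close> is the second function of the pairing.\<close>
  define d where "d = (\<lambda>e. c (\<tau> \<circ> e))"
  have dB: "d e \<in> bounded_borel" if "e \<in> ?E" for e using c edges_closed that by (simp add: d_def)
  have sub: "EF \<subseteq> ?E" "EL \<subseteq> ?E" "ER \<subseteq> ?E" using E by auto
  obtain B1 where B1: "\<And>x. \<bar>P EF c x\<bar> \<le> B1"
    using bounded_edge_prod[OF finE(1), of c] c sub unfolding P_def by blast
  obtain B2 where B2: "\<And>x. \<bar>P EL c x\<bar> \<le> B2"
    using bounded_edge_prod[OF finE(2), of c] c sub unfolding P_def by blast
  obtain B3 where B3: "\<And>x. \<bar>P EL d x\<bar> \<le> B3"
    using bounded_edge_prod[OF finE(2), of d] dB sub unfolding P_def by blast
  have in_V: "(i, e i) \<in> ?V" if "e \<in> ?E" for e i using edge_part that by (simp add: vertices_def)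
  have in_VF: "(i, e i) \<in> VF" if "e \<in> EF" for e i using that edge_part by (auto simp: defs)
  have in_VL: "(i, e i) \<in> VF \<union> VL" if "e \<in> EL" for e i
    using that edge_part cut by (auto simp: defs)
  let ?I = "\<lambda>f g. \<integral>x. P EF c x * (f x * g (\<lambda>i. x (\<sigma> i))) \<partial>unit_product (VF \<union> (VL \<union> VR))"
  have "\<bar>?I (P EL c) (P EL d)\<bar> \<le> (?I (P EL c) (P EL c) + ?I (P EL d) (P EL d)) / 2"
  proof (rule reflection_inequality[OF finV disjV disjVLR, where B = "max B1 (max B2 B3)"])
    show "\<sigma> ` VL \<subseteq> VR" "\<sigma> ` VR \<subseteq> VL"
      using part_closed involution by (auto simp: defs)
    show "\<sigma> i = i" if "i \<in> VF" for i using that fixed by (auto simp: defs)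
    show "\<sigma> (\<sigma> i) = i" if "i \<in> VL \<union> VR" for i using that involution by (auto simp: defs)
    show "P EF c x = P EF c y" if "\<And>i. i \<in> VF \<Longrightarrow> x i = y i" for x y
      unfolding P_def using that in_VF by (intro prod.cong refl arg_cong[where f = "c _"]) auto
    show "P EL c x = P EL c y" if "\<And>i. i \<in> VF \<union> VL \<Longrightarrow> x i = y i" for x y
      unfolding P_def using that in_VL by (intro prod.cong refl arg_cong[where f = "c _"]) simp
    show "P EL d x = P EL d y" if "\<And>i. i \<in> VF \<union> VL \<Longrightarrow> x i = y i" for x y
      unfolding P_def using that in_VL by (intro prod.cong refl arg_cong[where f = "d _"]) simp
    show "0 \<le> P EF c x" for x
      using middle
    proof
      \<comment> \<open>Every edge is moved, so none lies inside the fixed set and the middle factor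
        is an empty product.\<close>
      assume "\<forall>e\<in>?E. \<exists>i. \<tau> (e i) \<noteq> e i"
      then have "EF = {}" using fixed edge_part by (fastforce simp: EF_def)
      then show ?thesis by (simp add: P_def)
    qed (use sub in \<open>auto simp: P_def intro!: prod_nonneg\<close>)
    show "P EL c \<in> borel_measurable (unit_product (VF \<union> VL))"
      "P EL d \<in> borel_measurable (unit_product (VF \<union> VL))"
      unfolding P_def
      by (rule measurable_edge_prod, use c dB sub in_VL in blast, use in_VL in blast)+
    show "P EF c \<in> borel_measurable (unit_product (VF \<union> (VL \<union> VR)))"
      "P EL c \<in> borel_measurable (unit_product (VF \<union> (VL \<union> VR)))"
      "P EL d \<in> borel_measurable (unit_product (VF \<union> (VL \<union> VR)))"
      unfolding P_def V[symmetric]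
      by (rule measurable_edge_prod, use c dB sub in blast, use in_V sub in blast)+
  qed (use B1 B2 B3 in \<open>auto simp: le_max_iff_disj\<close>)
  moreover have "?I (P EL c) (P EL d) = colored_integral H c"
  proof -
    have "P ER (\<lambda>e. d (\<tau> \<circ> e)) = P ER c"
      unfolding P_def d_def by (intro ext prod.cong refl) (simp add: swap'(2))
    then show ?thesis by (simp only: split P_reflect)
  qed
  moreover have "?I (P EL c) (P EL c) = colored_integral H (\<lambda>e. c (fold_left e))"
  proof -
    have "P EF (\<lambda>e. c (fold_left e)) = P EF c" "P EL (\<lambda>e. c (fold_left e)) = P EL c"
      "P ER (\<lambda>e. c (fold_left e)) = P ER (\<lambda>e. c (\<tau> \<circ> e))"
      unfolding P_def fold_left_def
      by (intro ext prod.cong refl; use cut in \<open>auto simp: defs\<close>)+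
    then show ?thesis by (simp only: split P_reflect)
  qed
  moreover have "?I (P EL d) (P EL d) = colored_integral H (\<lambda>e. c (fold_right e))"
  proof -
    have "P EF (\<lambda>e. c (fold_right e)) = P EF c" "P EL (\<lambda>e. c (fold_right e)) = P EL d"
      "P ER (\<lambda>e. c (fold_right e)) = P ER (\<lambda>e. d (\<tau> \<circ> e))"
      unfolding P_def fold_right_def d_def
      by (intro ext prod.cong refl; use cut swap' in \<open>auto simp: defs\<close>)+
    then show ?thesis by (simp only: split P_reflect)
  qed
  ultimately show ?thesis by simp
qed

end

section \<open>Borel representatives and the distribution of an edge\<close>

lemma measurable_completion_AE:
  fixes F G :: "'a \<Rightarrow> real"
  assumes G: "G \<in> borel_measurable M" and ae: "AE x in M. F x = G x"
  shows "F \<in> borel_measurable (completion M)"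
proof (rule measurableI)
  fix A :: "real set" assume A: "A \<in> sets borel"
  show "F -` A \<inter> space (completion M) \<in> sets (completion M)"
  proof (rule completion.in_sets_AE)
    show "G -` A \<inter> space (completion M) \<in> sets (completion M)"
      using measurable_sets[OF measurable_completion[OF G] A] .
    show "AE x in completion M. (x \<in> G -` A \<inter> space (completion M)) = (x \<in> F -` A \<inter> space (completion M))"
      using AE_completion[OF ae] by eventually_elim auto
  qed auto
qed auto

lemma borel_representative:
  fixes f :: "real ^ 'k \<Rightarrow> real"
  assumes f: "f \<in> borel_measurable (lebesgue_on cube)" and ab: "a \<le> b" "\<And>x. x \<in> cube \<Longrightarrow> f x \<in> {a..b}"
  obtains g where "g \<in> borel_measurable borel" "\<forall>x. g x \<in> {a..b}" "AE x in lborel. x \<in> cube \<longrightarrow> f x = g x"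
proof -
  have "cube \<in> sets (lebesgue :: (real ^ 'k) measure)" by (simp add: interval_cbox_cart)
  then have "cube \<inter> space (lebesgue :: (real ^ 'k) measure) \<in> sets lebesgue" by simp
  from iffD1[OF borel_measurable_restrict_space_iff[OF this] f]
  have "\<exists>g\<in>borel_measurable lborel. AE x in lborel. indicator cube x *\<^sub>R f x = g x"
    by (rule completion_ex_borel_measurable_real)
  then obtain g where g: "g \<in> borel_measurable lborel" "AE x in lborel. indicator cube x *\<^sub>R f x = g x"
    by (rule bexE)
  \<comment> \<open>Clamping changes nothing at points of the cube where g agrees with f, and makes
    the bounds hold everywhere.\<close>
  let ?g = "\<lambda>x. max a (min b (g x))"
  have "g \<in> borel_measurable borel" using g(1) by (simp only: measurable_lborel2)
  then have "?g \<in> borel_measurable borel"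
    by (rule borel_measurable_max[OF borel_measurable_min[OF _ borel_measurable_const] borel_measurable_const])
  moreover have "\<forall>x. ?g x \<in> {a..b}" using ab(1) by simp
  moreover have "AE x in lborel. x \<in> cube \<longrightarrow> f x = ?g x"
    using g(2) by eventually_elim (use ab(2) in \<open>force simp: indicator_def\<close>)
  ultimately show thesis by (rule that)
qed

lemma emeasure_unit_atMost: "emeasure unit_measure ({0..1} \<inter> {..a}) = ennreal (max 0 (min 1 a))"
proof -
  have "{0..1} \<inter> {..a} = {0..min 1 a}" by auto
  then show ?thesis by (auto simp: emeasure_restrict_space max_def)
qed

lemma emeasure_cube_atMost:
  "emeasure lborel (cube \<inter> {..a :: real ^ 'k}) = (\<Prod>i\<in>UNIV. ennreal (max 0 (min 1 (a $ i))))"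
proof -
  let ?b = "\<chi> i. min 1 (a $ i)"
  have eq: "cube \<inter> {..a} = cbox 0 ?b"
    by (auto simp: less_eq_vec_def mem_box_cart interval_cbox_cart[symmetric])
  show ?thesis
  proof (cases "\<forall>i. 0 \<le> a $ i")
    case True
    then have "cbox 0 ?b \<noteq> {}" by (simp add: interval_ne_empty_cart)
    from content_cbox_cart[OF this]
    have "emeasure lborel (cbox 0 ?b) = ennreal (\<Prod>i\<in>UNIV. min 1 (a $ i))"
      using emeasure_lborel_cbox_finite[of 0 ?b] by (simp add: emeasure_eq_ennreal_measure)
    also have "\<dots> = (\<Prod>i\<in>UNIV. ennreal (min 1 (a $ i)))"
      using True by (subst prod_ennreal) auto
    finally show ?thesis using True unfolding eq by (simp add: max_def)
  next
    case False
    then obtain j where j: "a $ j < 0" by (auto simp: not_le)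
    then have "cbox 0 ?b = {}" by (auto simp: interval_eq_empty_cart intro!: exI[of _ j])
    moreover have "(\<Prod>i\<in>UNIV. ennreal (max 0 (min 1 (a $ i)))) = 0"
      using j by (intro prod_zero) (auto intro!: exI[of _ j])
    ultimately show ?thesis unfolding eq by simp
  qed
qed

text \<open>The vertices of an edge carry different part tags, so they are distinct and their
  coordinates are independent and uniform: the edge map is uniform on the cube. It suffices to
  compare distribution functions, as the lower orthants are closed under intersection and generate
  the Borel sets.\<close>

lemma distr_edge:
  fixes e :: "'k::finite \<Rightarrow> 'v"
  assumes e: "\<And>i. (i, e i) \<in> V"
  shows "distr (unit_product V) borel (\<lambda>x. \<chi> i. x (i, e i)) = density lborel (indicator cube)"
    (is "?D = ?N")
proof (rule measure_eqI_generator_eq[where E = "range (\<lambda>a. {..a})" and \<Omega> = UNIV and A = "\<lambda>n. {..\<chi> i. real n}"])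
  interpret product_prob_space "\<lambda>_. unit_measure" V by (rule product_prob_space_unit)
  show "Int_stable (range (\<lambda>a :: real ^ 'k. {..a}))"
  proof (rule Int_stableI)
    fix A B :: "(real ^ 'k) set" assume "A \<in> range (\<lambda>a. {..a})" "B \<in> range (\<lambda>a. {..a})"
    then obtain a b where "A = {..a}" "B = {..b}" by blast
    then have "A \<inter> B = {..\<chi> i. min (a $ i) (b $ i)}" by (auto simp: less_eq_vec_def)
    then show "A \<inter> B \<in> range (\<lambda>a. {..a})" by blast
  qed
  show "emeasure ?D X = emeasure ?N X" if X': "X \<in> range (\<lambda>a. {..a})" for X
  proof -
    obtain a where X: "X = {..a}" using X' by blast
    let ?J = "(\<lambda>i. (i, e i)) ` UNIV"
    have meas: "(\<lambda>x. \<chi> i. x (i, e i)) \<in> borel_measurable (unit_product V)"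
      using e by (rule measurable_edge)
    have sp: "x (i, e i) \<in> {0..1}" if "x \<in> space (unit_product V)" for x i
      using that e[of i] unfolding space_PiM by (auto simp: space_restrict_space dest: PiE_mem)
    have "emeasure ?D X = emeasure (unit_product V) ((\<lambda>x. \<chi> i. x (i, e i)) -` X \<inter> space (unit_product V))"
      by (rule emeasure_distr[OF meas]) (simp add: X)
    also have "(\<lambda>x. \<chi> i. x (i, e i)) -` X \<inter> space (unit_product V)
        = {x \<in> space (unit_product V). \<forall>j\<in>?J. x j \<in> {0..1} \<inter> {..a $ fst j}}"
      unfolding X using sp by (auto simp: less_eq_vec_def)
    also have "emeasure (unit_product V) \<dots> = (\<Prod>j\<in>?J. emeasure unit_measure ({0..1} \<inter> {..a $ fst j}))"
      using e by (intro emeasure_PiM_Collect) (auto simp: sets_restrict_space)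
    also have "\<dots> = (\<Prod>i\<in>UNIV. ennreal (max 0 (min 1 (a $ i))))"
    proof -
      have "inj (\<lambda>i. (i, e i))" by (rule injI) simp
      from prod.reindex[OF this, of "\<lambda>j. ennreal (max 0 (min 1 (a $ fst j)))"] show ?thesis
        by (simp only: emeasure_unit_atMost o_def fst_conv)
    qed
    also have "\<dots> = emeasure ?N X"
      unfolding X emeasure_cube_atMost[symmetric]
      by (simp add: emeasure_density indicator_inter_arith[symmetric] interval_cbox_cart)
    finally show ?thesis .
  qed
  show "sets ?D = sigma_sets UNIV (range (\<lambda>a. {..a}))" "sets ?N = sigma_sets UNIV (range (\<lambda>a. {..a}))"
    by (simp_all add: borel_eq_atMost)
  show "(\<Union>n. {..\<chi> i. real n}) = (UNIV :: (real ^ 'k) set)"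
  proof (intro equalityI subsetI)
    fix x :: "real ^ 'k"
    obtain n where n: "(\<Sum>i\<in>UNIV. \<bar>x $ i\<bar>) \<le> real n"
      using real_arch_simple[of "\<Sum>i\<in>UNIV. \<bar>x $ i\<bar>"] by (rule exE)
    have "x $ i \<le> real n" for i
    proof -
      have "\<bar>x $ i\<bar> \<le> (\<Sum>i\<in>UNIV. \<bar>x $ i\<bar>)" by (rule member_le_sum) simp_all
      with n show ?thesis by linarith
    qed
    then show "x \<in> (\<Union>n. {..\<chi> i. real n})" by (auto simp: less_eq_vec_def)
  qed auto
  show "emeasure ?D {..\<chi> i. real n} \<noteq> \<infinity>" for n
  proof -
    interpret D: prob_space ?D
      using prob_space_unit_product measurable_edge[OF e] by (rule prob_space.prob_space_distr)
    show ?thesis using D.emeasure_finite unfolding infinity_ennreal_def by blast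
  qed
qed auto

lemma AE_edge_iff:
  fixes e :: "'k::finite \<Rightarrow> 'v"
  assumes e: "\<And>i. (i, e i) \<in> V" and P: "{x. P x} \<in> sets borel"
  shows "(AE x in unit_product V. P (\<chi> i. x (i, e i))) \<longleftrightarrow> (AE x in lborel. x \<in> cube \<longrightarrow> P x)"
proof -
  have "(AE x in unit_product V. P (\<chi> i. x (i, e i))) \<longleftrightarrow>
      (AE x in distr (unit_product V) borel (\<lambda>x. \<chi> i. x (i, e i)). P x)"
    using P by (intro AE_distr_iff[symmetric] measurable_edge e) simp
  also have "\<dots> \<longleftrightarrow> (AE x in lborel. x \<in> cube \<longrightarrow> P x)"
    unfolding distr_edge[OF e] by (subst AE_density) (auto simp: indicator_def interval_cbox_cart)
  finally show ?thesis .
qed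

text \<open>Here P need not be measurable, so the exceptional set is enlarged to a Borel null set
  before it is pulled back along the edge map.\<close>

lemma AE_edge:
  fixes e :: "'k::finite \<Rightarrow> 'v"
  assumes e: "\<And>i. (i, e i) \<in> V" and P: "AE x in lborel. x \<in> cube \<longrightarrow> P x"
  shows "AE x in unit_product V. P (\<chi> i. x (i, e i))"
proof -
  obtain N where N: "N \<in> null_sets lborel" "{x. \<not> (x \<in> cube \<longrightarrow> P x)} \<subseteq> N"
    using P by (auto elim!: AE_E2 simp: eventually_ae_filter)
  have "AE x in lborel. x \<in> cube \<longrightarrow> (x \<in> cube \<and> x \<notin> N)" using AE_not_in[OF N(1)] by auto
  moreover have "{x. x \<in> cube \<and> x \<notin> N} \<in> sets borel"
  proof -
    have "cube - N \<in> sets borel" using N(1) by (auto simp: interval_cbox_cart)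
    also have "cube - N = {x. x \<in> cube \<and> x \<notin> N}" by auto
    finally show ?thesis .
  qed
  ultimately have "AE x in unit_product V. (\<chi> i. x (i, e i)) \<in> cube \<and> (\<chi> i. x (i, e i)) \<notin> N"
    by (subst AE_edge_iff[OF e, where P = "\<lambda>x. x \<in> cube \<and> x \<notin> N"])
  then show ?thesis by eventually_elim (use N(2) in blast)
qed

text \<open>Finitely many edges contribute one null set each, so the two integrands agree almost
  everywhere. The completion makes the original integrand measurable and leaves the integral of the
  representative unchanged.\<close>

lemma hom_integral_representative:
  fixes H :: "('k::finite, 'v) kgraph"
  assumes fin: "finite (edges H)" and part: "\<And>e i. e \<in> edges H \<Longrightarrow> e i \<in> part H i"
    and g: "g \<in> bounded_borel" and ae: "AE x in lborel. x \<in> cube \<longrightarrow> f x = g x"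
  shows "hom_integral H f = colored_integral H (\<lambda>_. g)"
proof -
  let ?M = "unit_product (vertices H)"
  let ?F = "\<lambda>f x. \<Prod>e\<in>edges H. f (\<chi> i. x (i, e i)) :: real"
  have V: "(i, e i) \<in> vertices H" if "e \<in> edges H" for e i
    using part that by (simp add: vertices_def)
  have "AE x in ?M. \<forall>e\<in>edges H. f (\<chi> i. x (i, e i)) = g (\<chi> i. x (i, e i))"
    using fin V by (intro AE_finite_allI AE_edge ae)
  then have AE: "AE x in ?M. ?F f x = ?F g x"
    by eventually_elim (auto intro: prod.cong)
  have meas: "?F g \<in> borel_measurable ?M"
    using g V by (intro measurable_edge_prod)
  have "hom_integral H f = (\<integral>x. ?F g x \<partial>completion ?M)"
    unfolding hom_integral_def
    by (intro integral_cong_AE measurable_completion_AE[OF meas AE] measurable_completion meas AE_completion AE)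
  also have "\<dots> = colored_integral H (\<lambda>_. g)"
    unfolding colored_integral_def by (rule integral_completion[OF meas])
  finally show ?thesis .
qed

section \<open>Maximal colourings\<close>

text \<open>If \<open>c\<close> maximises \<open>\<bar>I c\<bar>\<close>, then so does each of its folds. A composition of folds that
  collapses \<open>E\<close> to a single edge therefore yields a constant maximiser.\<close>

lemma maximal_coloring_bound:
  fixes I :: "('e \<Rightarrow> 'f) \<Rightarrow> real" and len :: "'e \<Rightarrow> nat"
  assumes finE: "finite E" and e0: "e\<^sub>0 \<in> E" and fin: "finite C"
    and cong: "\<And>c c'. (\<And>e. e \<in> E \<Longrightarrow> c e = c' e) \<Longrightarrow> I c = I c'"
    and closed: "\<And>\<phi> \<psi>. (\<phi>, \<psi>) \<in> Folds \<Longrightarrow> \<phi> ` E \<subseteq> E \<and> \<psi> ` E \<subseteq> E"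
    and ineq: "\<And>c \<phi> \<psi>. (\<phi>, \<psi>) \<in> Folds \<Longrightarrow> c ` E \<subseteq> C \<Longrightarrow>
      \<bar>I c\<bar> \<le> (I (\<lambda>e. c (\<phi> e)) + I (\<lambda>e. c (\<psi> e))) / 2"
    and mono: "\<And>\<phi> \<psi> e. (\<phi>, \<psi>) \<in> Folds \<Longrightarrow> e \<in> E \<Longrightarrow> len (\<phi> e) \<le> len e"
    and decr: "\<And>e. e \<in> E \<Longrightarrow> e \<noteq> e\<^sub>0 \<Longrightarrow> \<exists>\<phi> \<psi>. (\<phi>, \<psi>) \<in> Folds \<and> len (\<phi> e) < len e"
    and const: "\<And>f. f \<in> C \<Longrightarrow> \<bar>I (\<lambda>_. f)\<bar> \<le> 1"
    and c: "c ` E \<subseteq> C"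
  shows "\<bar>I c\<bar> \<le> 1"
proof -
  let ?F = "fst ` Folds"
  define comp :: "('e \<Rightarrow> 'e) list \<Rightarrow> 'e \<Rightarrow> 'e" where "comp fs = foldr (\<circ>) fs id" for fs
  have comp_simps: "comp [] e = e" "comp (\<phi> # fs) e = \<phi> (comp fs e)" for \<phi> fs e
    by (simp_all add: comp_def)
  have comp_closed: "comp fs e \<in> E" if "set fs \<subseteq> ?F" "e \<in> E" for fs e
    using that(1)
  proof (induction fs)
    case (Cons \<phi> fs)
    then obtain \<psi> where "(\<phi>, \<psi>) \<in> Folds" by auto
    with closed[OF this] Cons show ?case by (auto simp: comp_simps)
  qed (simp add: comp_simps that)
  \<comment> \<open>The total length of the images of all edges. A composition minimising it must
    collapse \<open>E\<close>: if some image differed from \<open>e\<^sub>0\<close>, one more fold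
    would lower the total, since folds lengthen nothing.\<close>
  define m where "m fs = (\<Sum>e\<in>E. len (comp fs e))" for fs
  obtain fs where fs: "set fs \<subseteq> ?F" and min: "\<And>gs. set gs \<subseteq> ?F \<Longrightarrow> m fs \<le> m gs"
    using ex_has_least_nat[of "\<lambda>fs. set fs \<subseteq> ?F" "[]" m] by auto
  have collapse: "comp fs e = e\<^sub>0" if e: "e \<in> E" for e
  proof (rule ccontr)
    assume "comp fs e \<noteq> e\<^sub>0"
    then obtain \<phi> \<psi> where \<phi>: "(\<phi>, \<psi>) \<in> Folds" "len (\<phi> (comp fs e)) < len (comp fs e)"
      using decr comp_closed[OF fs e] by blast
    have "m (\<phi> # fs) < m fs"
      unfolding m_def comp_simps
      using mono[OF \<phi>(1) comp_closed[OF fs]] \<phi>(2) e by (intro sum_strict_mono_ex1[OF finE]) auto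
    moreover have "set (\<phi> # fs) \<subseteq> ?F" using fs \<phi>(1) by force
    ultimately show False using min[of "\<phi> # fs"] by linarith
  qed
  \<comment> \<open>Restricting colourings to \<open>E\<close> makes them finite in number, so the
    maximum exists.\<close>
  let ?X = "(\<lambda>c. \<bar>I c\<bar>) ` (E \<rightarrow>\<^sub>E C)"
  define M where "M = Max ?X"
  have finX: "finite ?X" using finE fin by (intro finite_imageI finite_PiE) auto
  have le: "\<bar>I d\<bar> \<le> M" if "d ` E \<subseteq> C" for d
  proof -
    have "I d = I (restrict d E)" by (rule cong) simp
    moreover have "restrict d E \<in> E \<rightarrow>\<^sub>E C" using that by auto
    ultimately show ?thesis unfolding M_def by (intro Max_ge[OF finX]) auto
  qed
  have "restrict c E \<in> E \<rightarrow>\<^sub>E C" using c by auto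
  then have "?X \<noteq> {}" by blast
  from Max_in[OF finX this] obtain d where d: "d \<in> E \<rightarrow>\<^sub>E C" "\<bar>I d\<bar> = M" unfolding M_def by force
  \<comment> \<open>The outermost map of a composition acts on the colouring before the rest, so the
    induction on the list must let d vary.\<close>
  have maximal: "\<bar>I (\<lambda>e. d (comp fs e))\<bar> = M" if "set fs \<subseteq> ?F" "d ` E \<subseteq> C" "\<bar>I d\<bar> = M" for fs d
    using that
  proof (induction fs arbitrary: d)
    case (Cons \<phi> fs)
    then obtain \<psi> where f: "(\<phi>, \<psi>) \<in> Folds" by auto
    have sub: "(\<lambda>e. d (\<phi> e)) ` E \<subseteq> C" "(\<lambda>e. d (\<psi> e)) ` E \<subseteq> C"
      using closed[OF f] Cons.prems(2) by blast+
    \<comment> \<open>The mean of two numbers that are at most \<open>M\<close> can reach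
      \<open>M\<close> only if both equal \<open>M\<close>; so the fold has integral
      \<open>M\<close> itself, whatever the sign of the original integral.\<close>
    have "M \<le> (I (\<lambda>e. d (\<phi> e)) + I (\<lambda>e. d (\<psi> e))) / 2"
      using ineq[OF f Cons.prems(2)] by (simp only: Cons.prems(3))
    moreover have "I (\<lambda>e. d (\<psi> e)) \<le> M" using le[OF sub(2)] by (rule order_trans[OF abs_ge_self])
    ultimately have "M \<le> I (\<lambda>e. d (\<phi> e))" by simp
    then have "\<bar>I (\<lambda>e. d (\<phi> e))\<bar> = M"
      by (intro antisym le[OF sub(1)] order_trans[OF _ abs_ge_self])
    from Cons.IH[OF _ sub(1) this] Cons.prems(1) show ?case by (simp add: comp_simps)
  qed (simp add: comp_simps)
  have dC: "d ` E \<subseteq> C" using d(1) by auto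
  have "I (\<lambda>e. d (comp fs e)) = I (\<lambda>_. d e\<^sub>0)" by (rule cong) (simp add: collapse)
  then have "M = \<bar>I (\<lambda>_. d e\<^sub>0)\<bar>" using maximal[OF fs dC d(2)] by simp
  also have "\<dots> \<le> 1" using dC e0 by (intro const) auto
  finally show ?thesis using le[OF c] by linarith
qed

section \<open>From colour bounds to norms\<close>

lemma power_powr_inverse: "0 \<le> x \<Longrightarrow> 0 < n \<Longrightarrow> (x ^ n) powr (1 / real n) = x"
  by (cases "x = 0") (simp_all add: powr_realpow[symmetric] powr_powr)

lemma powr_inverse_power: "0 \<le> x \<Longrightarrow> 0 < n \<Longrightarrow> (x powr (1 / real n)) ^ n = x"
  by (cases "x = 0") (simp_all add: powr_realpow[symmetric] powr_powr)

lemma bounded_borelI: "g \<in> borel_measurable borel \<Longrightarrow> (\<And>x. \<bar>g x\<bar> \<le> B) \<Longrightarrow> g \<in> bounded_borel"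
  unfolding bounded_borel_def by blast

lemma bounded_borelD:
  assumes "g \<in> bounded_borel"
  shows "g \<in> borel_measurable borel" "\<exists>B. \<forall>x. \<bar>g x\<bar> \<le> B"
  using assms unfolding bounded_borel_def by blast+

lemma bounded_borel_add:
  assumes "f \<in> bounded_borel" "g \<in> bounded_borel"
  shows "(\<lambda>x. f x + g x) \<in> bounded_borel"
proof -
  obtain A where A: "\<forall>x. \<bar>f x\<bar> \<le> A" using bounded_borelD(2)[OF assms(1)] by (rule exE)
  obtain B where B: "\<forall>x. \<bar>g x\<bar> \<le> B" using bounded_borelD(2)[OF assms(2)] by (rule exE)
  have "\<bar>f x + g x\<bar> \<le> A + B" for x using A[rule_format, of x] B[rule_format, of x] by linarith
  then show ?thesis by (rule bounded_borelI[OF borel_measurable_add[OF assms[THEN bounded_borelD(1)]]])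
qed

lemma bounded_borel_scale:
  assumes "f \<in> bounded_borel"
  shows "(\<lambda>x. c * f x) \<in> bounded_borel"
proof -
  obtain A where A: "\<forall>x. \<bar>f x\<bar> \<le> A" using bounded_borelD(2)[OF assms(1)] by (rule exE)
  have "\<bar>c * f x\<bar> \<le> \<bar>c\<bar> * A" for x unfolding abs_mult by (intro mult_left_mono A[rule_format] abs_ge_zero)
  then show ?thesis by (rule bounded_borelI[OF borel_measurable_times[OF borel_measurable_const bounded_borelD(1)[OF assms]]])
qed

lemma bounded_borel_abs:
  assumes "f \<in> bounded_borel"
  shows "(\<lambda>x. \<bar>f x\<bar>) \<in> bounded_borel"
proof -
  obtain A where A: "\<forall>x. \<bar>f x\<bar> \<le> A" using bounded_borelD(2)[OF assms(1)] by (rule exE)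
  show ?thesis using A by (intro bounded_borelI[where B = A, OF borel_measurable_abs[OF bounded_borelD(1)[OF assms]]]) simp
qed

lemma const_bounded_borel: "(\<lambda>_. c) \<in> bounded_borel"
  by (rule bounded_borelI[of _ "\<bar>c\<bar>"]) simp_all

lemma colored_integral_cong:
  "(\<And>e. e \<in> edges H \<Longrightarrow> c e = c' e) \<Longrightarrow> colored_integral H c = colored_integral H c'"
  unfolding colored_integral_def by (intro Bochner_Integration.integral_cong refl prod.cong) simp

lemma colored_integral_scale:
  "colored_integral H (\<lambda>e x. s e * c e x) = (\<Prod>e\<in>edges H. s e) * colored_integral H c"
  unfolding colored_integral_def prod.distrib by (rule integral_mult_right_zero)

locale partite_kgraph =
  fixes H :: "('k::finite, 'v) kgraph"
  assumes finite_edges: "finite (edges H)" and edges_nonempty: "edges H \<noteq> {}"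
    and edge_part: "\<And>e i. e \<in> edges H \<Longrightarrow> e i \<in> part H i"
begin

abbreviation (input) edge_count :: nat where "edge_count \<equiv> card (edges H)"

lemma edge_count_pos: "0 < edge_count"
  using finite_edges edges_nonempty by (simp add: card_gt_0_iff)

lemma edge_vertex: "e \<in> edges H \<Longrightarrow> (i, e i) \<in> vertices H"
  using edge_part by (simp add: vertices_def)

lemma integrable_colored:
  assumes "\<And>e. e \<in> edges H \<Longrightarrow> c e \<in> bounded_borel"
  shows "integrable (unit_product (vertices H)) (\<lambda>x. \<Prod>e\<in>edges H. c e (\<chi> i. x (i, e i)))"
proof -
  obtain B where "\<And>x. \<bar>\<Prod>e\<in>edges H. c e (\<chi> i. x (i, e i))\<bar> \<le> B"
    using bounded_edge_prod[OF finite_edges, of c] assms by metis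
  moreover have "(\<lambda>x. \<Prod>e\<in>edges H. c e (\<chi> i. x (i, e i))) \<in> borel_measurable (unit_product (vertices H))"
    by (rule measurable_edge_prod) (simp_all add: assms edge_vertex)
  ultimately show ?thesis by (rule integrable_unit_product[rotated])
qed

definition color_norm :: "(real ^ 'k \<Rightarrow> real) \<Rightarrow> real" where
  "color_norm g = \<bar>colored_integral H (\<lambda>_. g)\<bar> powr (1 / edge_count)"

lemma color_norm_nonneg: "0 \<le> color_norm g"
  by (simp add: color_norm_def)

lemma kgraph_norm_representative:
  assumes "g \<in> bounded_borel" "AE x in lborel. x \<in> cube \<longrightarrow> f x = g x"
  shows "kgraph_norm H f = color_norm g"
  using hom_integral_representative[OF finite_edges _ assms] edge_part
  by (simp add: kgraph_norm_def color_norm_def)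

lemma kgraph_norm_scale: "kgraph_norm H (\<lambda>x. c * f x) = \<bar>c\<bar> * kgraph_norm H f"
proof -
  have "hom_integral H (\<lambda>x. c * f x) = c ^ edge_count * hom_integral H f"
    unfolding hom_integral_def prod.distrib prod_constant by (rule integral_mult_right_zero)
  then show ?thesis
    using power_powr_inverse[of "\<bar>c\<bar>" edge_count] edge_count_pos
    by (simp add: kgraph_norm_def abs_mult powr_mult power_abs)
qed

text \<open>Scaling \<open>f\<close> and \<open>g\<close> turns this into Hoelder's inequality for two functions.\<close>

definition color_bounded :: "(real ^ 'k \<Rightarrow> real) set \<Rightarrow> bool" where
  "color_bounded \<F> \<longleftrightarrow> \<F> \<subseteq> bounded_borel \<and> (\<forall>f\<in>\<F>. \<forall>c>0. (\<lambda>x. c * f x) \<in> \<F>) \<and>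
     (\<forall>f\<in>\<F>. \<forall>g\<in>\<F>. \<bar>colored_integral H (\<lambda>_. f)\<bar> \<le> 1 \<longrightarrow> \<bar>colored_integral H (\<lambda>_. g)\<bar> \<le> 1 \<longrightarrow>
       (\<forall>c. c ` edges H \<subseteq> {f, g} \<longrightarrow> \<bar>colored_integral H c\<bar> \<le> 1))"

text \<open>Dividing f by a and g by b brings both constant colourings down to at most 1; the
  divisors are then pulled out edge by edge. Strict inequalities keep the divisors positive even
  when a norm vanishes.\<close>

lemma color_bound:
  assumes F: "color_bounded \<F>" and f: "f \<in> \<F>" and g: "g \<in> \<F>"
    and a: "color_norm f < a" and b: "color_norm g < b"
  shows "\<bar>colored_integral H (\<lambda>e. if s e then f else g)\<bar> \<le> (\<Prod>e\<in>edges H. if s e then a else b)"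
proof -
  have pos: "0 < a" "0 < b"
    using a b color_norm_nonneg[of f] color_norm_nonneg[of g] by linarith+
  let ?f = "\<lambda>x. inverse a * f x" and ?g = "\<lambda>x. inverse b * g x"
  have small: "\<bar>colored_integral H (\<lambda>_ x. inverse r * h x)\<bar> \<le> 1" if "color_norm h < r" "0 < r" for r h
  proof -
    have "\<bar>colored_integral H (\<lambda>_. h)\<bar> = color_norm h ^ edge_count"
      using powr_inverse_power[of "\<bar>colored_integral H (\<lambda>_. h)\<bar>" edge_count] edge_count_pos
      by (simp add: color_norm_def)
    also have "\<dots> \<le> r ^ edge_count" using that color_norm_nonneg by (intro power_mono) auto
    finally have le: "\<bar>colored_integral H (\<lambda>_. h)\<bar> \<le> r ^ edge_count" .
    have "\<bar>colored_integral H (\<lambda>_ x. inverse r * h x)\<bar> = inverse (r ^ edge_count) * \<bar>colored_integral H (\<lambda>_. h)\<bar>"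
      using that(2) by (simp only: colored_integral_scale[of H "\<lambda>_. inverse r" "\<lambda>_. h"] prod_constant
          abs_mult power_inverse) simp
    also have "\<dots> \<le> inverse (r ^ edge_count) * r ^ edge_count"
      using le that(2) by (intro mult_left_mono) simp_all
    also have "\<dots> = 1" using that(2) by simp
    finally show ?thesis .
  qed
  let ?c = "\<lambda>e. if s e then ?f else ?g" and ?r = "\<lambda>e. if s e then a else b"
  have "(\<lambda>x. c * h x) \<in> \<F>" if "h \<in> \<F>" "0 < c" for h c
    using F that unfolding color_bounded_def by blast
  from this[OF f, of "inverse a"] this[OF g, of "inverse b"] have "?f \<in> \<F>" "?g \<in> \<F>"
    using pos by simp_all
  moreover have "?c ` edges H \<subseteq> {?f, ?g}" by auto
  ultimately have le1: "\<bar>colored_integral H ?c\<bar> \<le> 1"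
    using F small[OF a pos(1)] small[OF b pos(2)] unfolding color_bounded_def by blast
  have r: "0 < (\<Prod>e\<in>edges H. ?r e)" using pos by (intro prod_pos) auto
  have "colored_integral H (\<lambda>e. if s e then f else g) = colored_integral H (\<lambda>e x. ?r e * ?c e x)"
  proof (rule colored_integral_cong)
    show "(if s e then f else g) = (\<lambda>x. ?r e * ?c e x)" for e
      using pos by (cases "s e") (simp_all add: fun_eq_iff)
  qed
  also have "\<dots> = (\<Prod>e\<in>edges H. ?r e) * colored_integral H ?c" by (rule colored_integral_scale)
  finally have "\<bar>colored_integral H (\<lambda>e. if s e then f else g)\<bar> = (\<Prod>e\<in>edges H. ?r e) * \<bar>colored_integral H ?c\<bar>"
    using r by (simp only: abs_mult abs_of_pos)
  with le1 r show ?thesis by (simp only: mult_left_le less_imp_le)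
qed

text \<open>Each choice s of f or g on every edge contributes at most the matching product of a and
  b, and these products sum up to a power of a + b. The slack \<epsilon>/2 in a and b makes the
  inequalities strict as \<open>color_bound\<close> requires.\<close>

lemma color_norm_triangle:
  assumes F: "color_bounded \<F>" and f: "f \<in> \<F>" and g: "g \<in> \<F>"
  shows "color_norm (\<lambda>x. f x + g x) \<le> color_norm f + color_norm g"
proof (rule field_le_epsilon)
  fix \<epsilon> :: real assume "0 < \<epsilon>"
  define a b where "a = color_norm f + \<epsilon> / 2" and "b = color_norm g + \<epsilon> / 2"
  have a: "color_norm f < a" "0 < a" and b: "color_norm g < b" "0 < b"
    using \<open>0 < \<epsilon>\<close> color_norm_nonneg[of f] color_norm_nonneg[of g] by (auto simp: a_def b_def)
  have bb: "f \<in> bounded_borel" "g \<in> bounded_borel" using F f g by (auto simp: color_bounded_def)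
  let ?S = "edges H \<rightarrow>\<^sub>E (UNIV :: bool set)"
  let ?c = "\<lambda>s e. if s e then f else g"
  have "colored_integral H (\<lambda>_ x. f x + g x)
      = (\<integral>x. (\<Sum>s\<in>?S. \<Prod>e\<in>edges H. ?c s e (\<chi> i. x (i, e i))) \<partial>unit_product (vertices H))"
  proof -
    have "(\<Prod>e\<in>edges H. f (y e) + g (y e)) = (\<Sum>s\<in>?S. \<Prod>e\<in>edges H. ?c s e (y e))" for y
      using prod_sum_PiE[OF finite_edges, of "\<lambda>_. UNIV :: bool set" "\<lambda>e t. (if t then f else g) (y e)"]
      by (simp add: UNIV_bool add.commute)
    then show ?thesis unfolding colored_integral_def by simp
  qed
  also have "\<dots> = (\<Sum>s\<in>?S. colored_integral H (?c s))"
    unfolding colored_integral_def using bb by (intro Bochner_Integration.integral_sum integrable_colored) auto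
  finally have "\<bar>colored_integral H (\<lambda>_ x. f x + g x)\<bar> \<le> (\<Sum>s\<in>?S. \<bar>colored_integral H (?c s)\<bar>)"
    by (simp add: sum_abs)
  also have "\<dots> \<le> (\<Sum>s\<in>?S. \<Prod>e\<in>edges H. if s e then a else b)"
    by (intro sum_mono color_bound[OF F f g a(1) b(1)])
  also have "\<dots> = (a + b) ^ edge_count"
    using prod_sum_PiE[OF finite_edges, of "\<lambda>_. UNIV :: bool set" "\<lambda>e t. if t then a else b"]
    by (simp add: UNIV_bool add.commute)
  finally have "color_norm (\<lambda>x. f x + g x) \<le> ((a + b) ^ edge_count) powr (1 / edge_count)"
    unfolding color_norm_def by (intro powr_mono2) auto
  also have "\<dots> = a + b" using a b edge_count_pos by (intro power_powr_inverse) auto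
  finally show "color_norm (\<lambda>x. f x + g x) \<le> color_norm f + color_norm g + \<epsilon>"
    by (simp add: a_def b_def)
qed

section \<open>Transfer to Lebesgue measurable functions\<close>

lemma representative:
  fixes f :: "real ^ 'k \<Rightarrow> real"
  assumes f: "f \<in> bounded_measurable"
  obtains g where "g \<in> bounded_borel" "AE x in lborel. x \<in> cube \<longrightarrow> f x = g x"
proof -
  have "bounded (f ` cube)" using f unfolding bounded_measurable_def by blast
  then obtain B where "\<forall>y\<in>f ` cube. norm y \<le> B" unfolding bounded_iff by (rule exE)
  then have B: "\<bar>f x\<bar> \<le> B" if "x \<in> cube" for x using that by simp
  have "(0 :: real ^ 'k) \<in> cube" by (simp add: less_eq_vec_def)
  from B[OF this] have "- B \<le> B" by linarith
  have meas: "f \<in> borel_measurable (lebesgue_on cube)" using f unfolding bounded_measurable_def by blast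
  have "f x \<in> {- B..B}" if "x \<in> cube" for x using B[OF that] by (simp add: abs_le_iff)
  then obtain g where g: "g \<in> borel_measurable borel" "\<forall>x. g x \<in> {- B..B}"
    "AE x in lborel. x \<in> cube \<longrightarrow> f x = g x"
    by (rule borel_representative[OF meas \<open>- B \<le> B\<close>])
  have "\<bar>g x\<bar> \<le> B" for x using g(2)[rule_format, of x] by (simp add: abs_le_iff)
  then have "g \<in> bounded_borel" by (rule bounded_borelI[OF g(1)])
  then show thesis using g(3) by (rule that)
qed

lemma norming_if_color_bounded:
  assumes F: "color_bounded bounded_borel"
  shows "norming H"
  unfolding norming_def is_seminorm_def
proof (intro conjI ballI allI)
  fix f g :: "real ^ 'k \<Rightarrow> real" assume f: "f \<in> bounded_measurable" and g: "g \<in> bounded_measurable"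
  obtain f' where f': "f' \<in> bounded_borel" "AE x in lborel. x \<in> cube \<longrightarrow> f x = f' x"
    using representative[OF f] .
  obtain g' where g': "g' \<in> bounded_borel" "AE x in lborel. x \<in> cube \<longrightarrow> g x = g' x"
    using representative[OF g] .
  have "AE x in lborel. x \<in> cube \<longrightarrow> f x + g x = f' x + g' x"
    using f'(2) g'(2) by eventually_elim simp
  with color_norm_triangle[OF F f'(1) g'(1)]
  show "kgraph_norm H (\<lambda>x. f x + g x) \<le> kgraph_norm H f + kgraph_norm H g"
    using kgraph_norm_representative f' g' bounded_borel_add[OF f'(1) g'(1)] by simp
qed (simp_all only: kgraph_norm_scale, simp add: kgraph_norm_def)

lemma color_norm_mono:
  assumes f: "f \<in> bounded_borel" and g: "g \<in> bounded_borel" and fg: "\<And>x. 0 \<le> f x" "\<And>x. f x \<le> g x"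
  shows "color_norm f \<le> color_norm g"
proof -
  have "colored_integral H (\<lambda>_. f) \<le> colored_integral H (\<lambda>_. g)"
    unfolding colored_integral_def using f g fg
    by (intro integral_mono integrable_colored prod_mono) auto
  moreover have "0 \<le> colored_integral H (\<lambda>_. f)"
    unfolding colored_integral_def using fg(1) by (intro Bochner_Integration.integral_nonneg prod_nonneg) auto
  ultimately show ?thesis unfolding color_norm_def by (intro powr_mono2) auto
qed

lemma AE_lebesgue_on_cube: "(AE x in lebesgue_on cube. P x) \<longleftrightarrow> (AE x in lborel. x \<in> (cube :: (real ^ 'k) set) \<longrightarrow> P x)"
  by (simp add: AE_restrict_space_iff interval_cbox_cart AE_completion_iff)

text \<open>Colour one edge by g and all others by 1. Since g has norm 0, the colour bound lets the
  factor of that edge be arbitrarily small, so g has integral 0 over that edge. It vanishes almost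
  everywhere on the cube because the edge map is uniformly distributed there.\<close>

lemma color_norm_zero:
  assumes F: "color_bounded {g \<in> bounded_borel. \<forall>x. 0 \<le> g x}"
    and g: "g \<in> bounded_borel" "\<And>x. 0 \<le> g x" and zero: "color_norm g = 0"
  shows "AE x in lborel. x \<in> cube \<longrightarrow> g x = 0"
proof -
  obtain e0 where e0: "e0 \<in> edges H" using edges_nonempty by blast
  let ?c = "\<lambda>e. if e = e0 then g else (\<lambda>_. 1)"
  \<comment> \<open>Any number above 1, the norm of the constant function 1, would serve in place of
    2.\<close>
  let ?K = "\<Prod>e\<in>edges H - {e0}. 2 :: real"
  let ?M = "unit_product (vertices H)"
  have c: "(\<Prod>e\<in>edges H. ?c e (y e)) = g (y e0)" for y
    using e0 finite_edges by (subst prod.remove[of _ e0]) (auto intro!: prod.neutral)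
  interpret prob_space ?M by (rule prob_space_unit_product)
  have one: "color_norm (\<lambda>_. 1) = 1" by (simp add: color_norm_def colored_integral_def prob_space)
  have "\<bar>colored_integral H ?c\<bar> \<le> a * ?K" if "0 < a" for a
  proof -
    have "\<bar>colored_integral H ?c\<bar> \<le> (\<Prod>e\<in>edges H. if e = e0 then a else 2)"
      using g that one zero const_bounded_borel by (intro color_bound[OF F]) auto
    also have "\<dots> = a * ?K"
      using e0 finite_edges by (subst prod.remove[of _ e0]) (auto intro!: prod.cong)
    finally show ?thesis .
  qed
  from this[of "\<epsilon> / ?K" for \<epsilon>] have "\<bar>colored_integral H ?c\<bar> \<le> 0 + \<epsilon>" if "0 < \<epsilon>" for \<epsilon>
    using that by simp
  then have "\<bar>colored_integral H ?c\<bar> \<le> 0" by (rule field_le_epsilon)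
  then have "(\<integral>x. g (\<chi> i. x (i, e0 i)) \<partial>?M) = 0" unfolding colored_integral_def c by simp
  moreover have "integrable ?M (\<lambda>x. g (\<chi> i. x (i, e0 i)))"
  proof -
    have "?c e \<in> bounded_borel" for e
      using g(1) const_bounded_borel[of 1] by (cases "e = e0") simp_all
    then show ?thesis using integrable_colored[of ?c] by (simp only: c)
  qed
  ultimately have "AE x in ?M. g (\<chi> i. x (i, e0 i)) = 0"
    using g(2) by (subst (asm) integral_nonneg_eq_0_iff_AE) auto
  moreover have "{x. g x = 0} \<in> sets borel"
  proof -
    have "g -` {0} \<inter> space borel \<in> sets borel"
      by (rule measurable_sets[OF bounded_borelD(1)[OF g(1)]]) simp
    also have "g -` {0} \<inter> space borel = {x. g x = 0}" unfolding space_borel by blast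
    finally show ?thesis .
  qed
  ultimately show ?thesis using AE_edge_iff[OF edge_vertex[OF e0], of "\<lambda>x. g x = 0"] by blast
qed

lemma weakly_norming_if_color_bounded:
  assumes F: "color_bounded {g \<in> bounded_borel. \<forall>x. 0 \<le> g x}"
  shows "weakly_norming H"
  unfolding weakly_norming_def is_norm_def is_seminorm_def
proof (intro conjI ballI allI)
  fix f :: "real ^ 'k \<Rightarrow> real" assume f: "f \<in> bounded_measurable"
  show "0 \<le> kgraph_norm H (\<lambda>x. \<bar>f x\<bar>)" by (simp add: kgraph_norm_def)
  show "kgraph_norm H (\<lambda>x. \<bar>c * f x\<bar>) = \<bar>c\<bar> * kgraph_norm H (\<lambda>x. \<bar>f x\<bar>)" for c
    using kgraph_norm_scale[of "\<bar>c\<bar>" "\<lambda>x. \<bar>f x\<bar>"] by (simp add: abs_mult)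
  obtain f' where f': "f' \<in> bounded_borel" "AE x in lborel. x \<in> cube \<longrightarrow> f x = f' x"
    using representative[OF f] .
  have absf: "(\<lambda>x. \<bar>f' x\<bar>) \<in> bounded_borel" "AE x in lborel. x \<in> cube \<longrightarrow> \<bar>f x\<bar> = \<bar>f' x\<bar>"
    using bounded_borel_abs[OF f'(1)] f'(2) by (auto elim!: eventually_mono)
  note nf = kgraph_norm_representative[OF absf]
  show "kgraph_norm H (\<lambda>x. \<bar>f x\<bar>) = 0 \<longleftrightarrow> (AE x in lebesgue_on cube. f x = 0)"
  proof
    assume "kgraph_norm H (\<lambda>x. \<bar>f x\<bar>) = 0"
    then have "AE x in lborel. x \<in> cube \<longrightarrow> \<bar>f' x\<bar> = 0"
      using nf by (intro color_norm_zero[OF F absf(1)]) auto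
    with f'(2) have "AE x in lborel. x \<in> cube \<longrightarrow> f x = 0" by eventually_elim simp
    then show "AE x in lebesgue_on cube. f x = 0" by (simp only: AE_lebesgue_on_cube)
  next
    assume "AE x in lebesgue_on cube. f x = 0"
    then have "AE x in lborel. x \<in> cube \<longrightarrow> \<bar>f x\<bar> = 0" by (simp add: AE_lebesgue_on_cube)
    then have "kgraph_norm H (\<lambda>x. \<bar>f x\<bar>) = color_norm (\<lambda>_. 0)"
      by (intro kgraph_norm_representative const_bounded_borel)
    also have "\<dots> = 0"
      using edge_count_pos by (simp add: color_norm_def colored_integral_def zero_power)
    finally show "kgraph_norm H (\<lambda>x. \<bar>f x\<bar>) = 0" .
  qed
  fix g :: "real ^ 'k \<Rightarrow> real" assume g: "g \<in> bounded_measurable"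
  obtain g' where g': "g' \<in> bounded_borel" "AE x in lborel. x \<in> cube \<longrightarrow> g x = g' x"
    using representative[OF g] .
  have absg: "(\<lambda>x. \<bar>g' x\<bar>) \<in> bounded_borel" "AE x in lborel. x \<in> cube \<longrightarrow> \<bar>g x\<bar> = \<bar>g' x\<bar>"
    using bounded_borel_abs[OF g'(1)] g'(2) by (auto elim!: eventually_mono)
  note ng = kgraph_norm_representative[OF absg]
  have sum: "(\<lambda>x. f' x + g' x) \<in> bounded_borel" by (rule bounded_borel_add[OF f'(1) g'(1)])
  have "AE x in lborel. x \<in> cube \<longrightarrow> \<bar>f x + g x\<bar> = \<bar>f' x + g' x\<bar>"
    using f'(2) g'(2) by eventually_elim simp
  then have "kgraph_norm H (\<lambda>x. \<bar>f x + g x\<bar>) = color_norm (\<lambda>x. \<bar>f' x + g' x\<bar>)"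
    by (intro kgraph_norm_representative bounded_borel_abs[OF sum])
  \<comment> \<open>The colour bound covers nonnegative functions only, so monotonicity passes to
    the sum of the absolute values before the triangle inequality is applied.\<close>
  also have "\<dots> \<le> color_norm (\<lambda>x. \<bar>f' x\<bar> + \<bar>g' x\<bar>)"
    by (intro color_norm_mono bounded_borel_abs[OF sum] bounded_borel_add[OF absf(1) absg(1)]) auto
  also have "\<dots> \<le> color_norm (\<lambda>x. \<bar>f' x\<bar>) + color_norm (\<lambda>x. \<bar>g' x\<bar>)"
    using absf(1) absg(1) by (intro color_norm_triangle[OF F]) auto
  finally show "kgraph_norm H (\<lambda>x. \<bar>f x + g x\<bar>) \<le> kgraph_norm H (\<lambda>x. \<bar>f x\<bar>) + kgraph_norm H (\<lambda>x. \<bar>g x\<bar>)"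
    by (simp only: nf ng)
qed

end

section \<open>Finite reflection groups\<close>

lemma group_GL: "group (GL :: (real ^ 'n ^ 'n) monoid)"
proof (rule groupI)
  fix x :: "real ^ 'n ^ 'n" assume "x \<in> carrier GL"
  then show "\<exists>y\<in>carrier GL. y \<otimes>\<^bsub>GL\<^esub> x = \<one>\<^bsub>GL\<^esub>"
    by (auto simp: GL_def invertible_def)
next
  show "\<one>\<^bsub>GL\<^esub> \<in> carrier (GL :: (real ^ 'n ^ 'n) monoid)"
    by (simp add: GL_def invertible_def exI[of _ "mat 1"])
qed (simp_all add: GL_def invertible_mult matrix_mul_assoc)

lemma mult_GL [simp]: "x \<otimes>\<^bsub>GL\<^esub> y = x ** y" and one_GL [simp]: "\<one>\<^bsub>GL\<^esub> = mat 1"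
  by (simp_all add: GL_def)

section \<open>Words in involutions\<close>

definition word :: "(real ^ 'n ^ 'n) list \<Rightarrow> real ^ 'n ^ 'n" where
  "word xs = foldr (**) xs (mat 1)"

lemma word_simps [simp]: "word [] = mat 1" "word (x # xs) = x ** word xs"
  by (simp_all add: word_def)

lemma word_append: "word (xs @ ys) = word xs ** word ys"
  by (induction xs) (simp_all add: matrix_mul_assoc)

lemma word_in_generate: "set xs \<subseteq> T \<Longrightarrow> word xs \<in> generate GL T"
proof (induction xs)
  case Nil
  then show ?case using generate.one[of GL T] by simp
next
  case (Cons x xs)
  then have "x \<otimes>\<^bsub>GL\<^esub> word xs \<in> generate GL T"
    by (intro generate.eng) (auto intro: generate.incl)
  then show ?case by simp
qed

text \<open>Each generator is its own inverse, so words without inverse letters already exhaust the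
  generated group.\<close>

lemma generate_involutions:
  assumes inv: "\<And>t. t \<in> T \<Longrightarrow> t ** t = mat 1" and w: "w \<in> generate GL T"
  obtains xs where "set xs \<subseteq> T" "w = word xs"
proof -
  have "\<exists>xs. set xs \<subseteq> T \<and> w = word xs"
    using w
  proof (induction rule: generate.induct)
    case one
    show ?case by (intro exI[of _ "[]"]) simp
  next
    case (incl h)
    then show ?case by (intro exI[of _ "[h]"]) simp
  next
    case (inv h)
    have "h \<in> carrier GL" using assms(1)[OF inv] by (auto simp: GL_def invertible_def)
    then have "inv\<^bsub>GL\<^esub> h = h"
      using assms(1)[OF inv] by (intro group.inv_equality[OF group_GL]) auto
    with inv show ?case by (intro exI[of _ "[h]"]) simp
  next
    case (eng h1 h2)
    then obtain xs ys where "set xs \<subseteq> T" "h1 = word xs" "set ys \<subseteq> T" "h2 = word ys" by blast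
    then show ?case by (intro exI[of _ "xs @ ys"]) (simp add: word_append)
  qed
  with that show thesis by blast
qed

section \<open>The invariant inner product and its reflections\<close>

locale reflection_group =
  fixes W :: "(real ^ 'n ^ 'n) set" and \<Phi> \<Delta> :: "(real ^ 'n) set"
  assumes finite_reflection_group: "finite_reflection_group W"
    and root_system: "root_system_of W \<Phi>"
    and simple_system: "simple_system \<Phi> \<Delta>"
begin

lemma subgroup_W: "subgroup W GL" and finite_W: "finite W"
  using finite_reflection_group by (auto simp: finite_reflection_group_def)

lemma one_in_W: "mat 1 \<in> W"
  using subgroup.one_closed[OF subgroup_W] by simp

lemma mult_in_W: "g \<in> W \<Longrightarrow> h \<in> W \<Longrightarrow> g ** h \<in> W"
  using subgroup.m_closed[OF subgroup_W] by simp

lemma invertible_W: "g \<in> W \<Longrightarrow> invertible g"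
  using subgroup.subset[OF subgroup_W] by (auto simp: GL_def)

lemma W_inverse:
  assumes "g \<in> W"
  shows "matrix_inv g \<in> W" "matrix_inv g ** g = mat 1" "g ** matrix_inv g = mat 1"
proof -
  show 1: "matrix_inv g ** g = mat 1" "g ** matrix_inv g = mat 1"
    using someI_ex[OF invertible_W[OF assms, unfolded invertible_def]] by (simp_all add: matrix_inv_def)
  have "matrix_inv g \<in> carrier GL" using 1 by (auto simp: GL_def invertible_def)
  then have "inv\<^bsub>GL\<^esub> g = matrix_inv g"
    using 1 invertible_W[OF assms]
    by (intro group.inv_equality[OF group_GL]) (auto simp: GL_def)
  then show "matrix_inv g \<in> W"
    using subgroup.m_inv_closed[OF subgroup_W assms] by simp
qed

lemma inverse_vector:
  "g \<in> W \<Longrightarrow> g *v (matrix_inv g *v v) = v"  "g \<in> W \<Longrightarrow> matrix_inv g *v (g *v v) = v"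
  by (simp_all add: matrix_vector_mul_assoc W_inverse)

lemma W_cancel: "g \<in> W \<Longrightarrow> g ** (matrix_inv g ** h) = h"  "g \<in> W \<Longrightarrow> matrix_inv g ** (g ** h) = h"
  by (simp_all add: matrix_mul_assoc W_inverse)

text \<open>The Euclidean inner product summed over \<open>W\<close>; right multiplication by an
  element of \<open>W\<close> only permutes the summands, which makes it invariant.\<close>

definition form :: "real ^ 'n \<Rightarrow> real ^ 'n \<Rightarrow> real" where
  "form u v = (\<Sum>g\<in>W. (g *v u) \<bullet> (g *v v))"

lemma form_sym: "form u v = form v u"
  by (simp add: form_def inner_commute)

lemma form_linear:
  "form (u + v) w = form u w + form v w"
  "form (u - v) w = form u w - form v w"
  "form (c *\<^sub>R u) w = c * form u w"
  "form (- u) w = - form u w"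
  "form 0 w = 0"
proof -
  have "g *v (- u) = - (g *v u)" for g :: "real ^ 'n ^ 'n"
    using matrix_vector_mult_scaleR[of g "-1" u] by simp
  then show "form (- u) w = - form u w"
    by (simp add: form_def sum_negf)
qed (simp_all add: form_def matrix_vector_right_distrib matrix_vector_mult_diff_distrib
      matrix_vector_mult_scaleR inner_add_left inner_diff_left sum.distrib sum_subtractf
      sum_distrib_left)

lemma form_scale_right: "form w (c *\<^sub>R u) = c * form w u"
  by (metis form_linear(3) form_sym)

lemma form_pos: "u \<noteq> 0 \<Longrightarrow> form u u > 0"
  unfolding form_def
proof (rule sum_pos2[OF finite_W one_in_W])
qed auto

lemma form_invariant:
  assumes h: "h \<in> W"
  shows "form (h *v u) (h *v v) = form u v"
proof -
  have "bij_betw (\<lambda>g. g ** h) W W"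
    by (rule bij_betw_byWitness[where f' = "\<lambda>g. g ** matrix_inv h"])
       (auto simp: mult_in_W h W_inverse matrix_mul_assoc[symmetric])
  from sum.reindex_bij_betw[OF this, of "\<lambda>g. (g *v u) \<bullet> (g *v v)"]
  show ?thesis by (simp add: form_def matrix_vector_mul_assoc)
qed

definition refl :: "real ^ 'n \<Rightarrow> real ^ 'n ^ 'n" where
  "refl \<alpha> = matrix (\<lambda>v. v - (2 * form v \<alpha> / form \<alpha> \<alpha>) *\<^sub>R \<alpha>)"

lemma refl_apply: "refl \<alpha> *v v = v - (2 * form v \<alpha> / form \<alpha> \<alpha>) *\<^sub>R \<alpha>"
proof -
  have "linear (\<lambda>v. v - (2 * form v \<alpha> / form \<alpha> \<alpha>) *\<^sub>R \<alpha>)"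
    by (rule linearI) (simp_all add: form_linear algebra_simps add_divide_distrib flip: scaleR_add_left)
  then show ?thesis by (simp add: refl_def matrix_works)
qed

text \<open>Invariance of \<open>form\<close> forces every fixed vector of s to be orthogonal to
  \<alpha>, and the dimensions then make the fixed space the whole orthogonal complement. So s is
  determined by \<alpha>.\<close>

lemma reflection_along_unique:
  assumes s: "s \<in> W" and r: "reflection_along \<alpha> s"
  shows "s = refl \<alpha>"
proof -
  let ?F = "{v. s *v v = v}" and ?H = "{v. form v \<alpha> = 0}"
  have a: "\<alpha> \<noteq> 0" and sa: "s *v \<alpha> = - \<alpha>" using r by (auto simp: reflection_along_def)
  have "form v \<alpha> = 0" if "s *v v = v" for v
  proof -
    have "form v \<alpha> = form v (- \<alpha>)" using form_invariant[OF s, of v \<alpha>] that sa by simp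
    also have "\<dots> = - form v \<alpha>" by (metis form_linear(4) form_sym)
    finally show ?thesis by simp
  qed
  then have FH: "?F \<subseteq> ?H" by blast
  have subF: "subspace ?F"
    by (auto simp: subspace_def matrix_vector_right_distrib matrix_vector_mult_scaleR)
  have subH: "subspace ?H" by (auto simp: subspace_def form_linear)
  have "\<alpha> \<notin> ?H" using form_pos[OF a] by auto
  then have "dim ?H < CARD('n)"
    using dim_eq_full[of ?H] subH dim_subset_UNIV[of ?H] by (auto simp: span_eq_iff[THEN iffD2])
  then have "dim ?H \<le> dim ?F" using r by (simp add: reflection_along_def)
  with subspace_dim_equal[OF subF subH FH] have FH: "?F = ?H" by simp
  have "s *v v = refl \<alpha> *v v" for v
  proof -
    let ?c = "form v \<alpha> / form \<alpha> \<alpha>"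
    have "v - ?c *\<^sub>R \<alpha> \<in> ?H" using form_pos[OF a] by (simp add: form_linear)
    then have "s *v (v - ?c *\<^sub>R \<alpha>) = v - ?c *\<^sub>R \<alpha>" using FH by blast
    then have "s *v v = v - ?c *\<^sub>R \<alpha> - ?c *\<^sub>R \<alpha>"
      by (simp add: matrix_vector_mult_diff_distrib matrix_vector_mult_scaleR sa algebra_simps)
    then show ?thesis by (simp add: refl_apply diff_diff_eq flip: scaleR_add_left)
  qed
  then show ?thesis by (simp add: matrix_eq)
qed

lemma finite_roots: "finite \<Phi>" and zero_notin_roots: "0 \<notin> \<Phi>"
  and roots_invariant: "w \<in> W \<Longrightarrow> \<beta> \<in> \<Phi> \<Longrightarrow> w *v \<beta> \<in> \<Phi>"
  and roots_line: "\<alpha> \<in> \<Phi> \<Longrightarrow> \<Phi> \<inter> span {\<alpha>} = {\<alpha>, - \<alpha>}"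
  using root_system by (auto simp: root_system_of_def)

lemma refl_in_W: "\<alpha> \<in> \<Phi> \<Longrightarrow> refl \<alpha> \<in> W \<and> reflection_along \<alpha> (refl \<alpha>)"
  using root_system reflection_along_unique unfolding root_system_of_def by metis

lemma reflections_of_eq: "A \<subseteq> \<Phi> \<Longrightarrow> reflections_of W A = refl ` A"
  using refl_in_W reflection_along_unique unfolding reflections_of_def by blast

lemma refl_self: "\<alpha> \<noteq> 0 \<Longrightarrow> refl \<alpha> *v \<alpha> = - \<alpha>"
  using form_pos[of \<alpha>] by (simp add: refl_apply scaleR_2)

lemma refl_scale: "c \<noteq> 0 \<Longrightarrow> refl (c *\<^sub>R \<alpha>) = refl \<alpha>"
  by (simp add: matrix_eq refl_apply form_linear form_scale_right)

lemma refl_uminus: "refl (- \<alpha>) = refl \<alpha>"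
  using refl_scale[of "-1" \<alpha>] by simp

lemma refl_conj:
  assumes "w \<in> W"
  shows "refl (w *v \<beta>) ** w = w ** refl \<beta>"
proof -
  have "refl (w *v \<beta>) *v (w *v v) = w *v (refl \<beta> *v v)" for v
    by (simp add: refl_apply form_invariant assms matrix_vector_mult_diff_distrib matrix_vector_mult_scaleR)
  then show ?thesis by (simp add: matrix_eq matrix_vector_mul_assoc[symmetric])
qed

lemma refl_involution: assumes "\<alpha> \<noteq> 0" shows "refl \<alpha> ** refl \<alpha> = mat 1"
proof -
  have "refl \<alpha> *v (refl \<alpha> *v v) = v" for v
    using refl_self[OF assms]
    by (subst (2) refl_apply) (simp add: matrix_vector_mult_diff_distrib matrix_vector_mult_scaleR refl_apply[of \<alpha> v])
  then show ?thesis by (simp add: matrix_eq matrix_vector_mul_assoc[symmetric])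
qed

lemma refl_cancel: "\<alpha> \<noteq> 0 \<Longrightarrow> refl \<alpha> ** (refl \<alpha> ** h) = h"
  by (simp add: matrix_mul_assoc refl_involution)

lemma refl_refl_apply: "\<alpha> \<noteq> 0 \<Longrightarrow> refl \<alpha> *v (refl \<alpha> *v v) = v"
  by (simp add: matrix_vector_mul_assoc refl_involution)

section \<open>Signs of roots and the exchange condition\<close>

lemma simple_subset: "\<Delta> \<subseteq> \<Phi>" and independent_simple: "independent \<Delta>"
  and roots_span: "\<beta> \<in> \<Phi> \<Longrightarrow> \<beta> \<in> span \<Delta>"
  using simple_system span_base[of _ \<Phi>] by (auto simp: simple_system_def)

lemma finite_simple: "finite \<Delta>"
  using simple_subset finite_roots finite_subset by blast

lemma simple_nonzero: "\<alpha> \<in> \<Delta> \<Longrightarrow> \<alpha> \<noteq> 0"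
  using simple_subset zero_notin_roots by blast

definition coord :: "real ^ 'n \<Rightarrow> real ^ 'n \<Rightarrow> real" where
  "coord = representation \<Delta>"

lemma coord_sum: "\<beta> \<in> \<Phi> \<Longrightarrow> (\<Sum>\<alpha>\<in>\<Delta>. coord \<beta> \<alpha> *\<^sub>R \<alpha>) = \<beta>"
  unfolding coord_def
  using sum_representation_eq[OF independent_simple roots_span finite_simple order_refl] by blast

lemma coord_refl:
  assumes a: "\<alpha> \<in> \<Delta>" and b: "\<beta> \<in> \<Phi>"
  shows "coord (refl \<alpha> *v \<beta>) \<gamma> = coord \<beta> \<gamma> - (if \<gamma> = \<alpha> then 2 * form \<beta> \<alpha> / form \<alpha> \<alpha> else 0)"
  using a b simple_subset unfolding coord_def refl_apply
  by (simp add: representation_diff representation_scale representation_basis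
      independent_simple roots_span span_base span_scale)

definition positive :: "real ^ 'n \<Rightarrow> bool" where
  "positive \<beta> \<longleftrightarrow> \<beta> \<in> \<Phi> \<and> (\<forall>\<alpha>\<in>\<Delta>. coord \<beta> \<alpha> \<ge> 0)"

lemma uminus_root: assumes "\<beta> \<in> \<Phi>" shows "- \<beta> \<in> \<Phi>"
  using roots_line[OF assms] by blast

lemma coord_uminus: "\<beta> \<in> \<Phi> \<Longrightarrow> coord (- \<beta>) \<alpha> = - coord \<beta> \<alpha>"
  unfolding coord_def by (simp add: representation_neg independent_simple roots_span)

lemma positive_cases:
  assumes b: "\<beta> \<in> \<Phi>"
  shows "positive \<beta> \<or> positive (- \<beta>)"
proof -
  obtain c where c: "\<beta> = (\<Sum>\<alpha>\<in>\<Delta>. c \<alpha> *\<^sub>R \<alpha>)"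
    and sgn: "(\<forall>\<alpha>\<in>\<Delta>. c \<alpha> \<ge> 0) \<or> (\<forall>\<alpha>\<in>\<Delta>. c \<alpha> \<le> 0)"
    using simple_system b unfolding simple_system_def by blast
  have "coord \<beta> \<alpha> = c \<alpha>" if "\<alpha> \<in> \<Delta>" for \<alpha>
  proof -
    have "coord \<beta> \<alpha> = (\<Sum>\<gamma>\<in>\<Delta>. c \<gamma> * (if \<alpha> = \<gamma> then 1 else 0))"
      unfolding c coord_def
      by (simp add: representation_sum representation_scale representation_basis
          independent_simple span_base span_scale)
    also have "\<dots> = c \<alpha>"
      using that finite_simple by (simp add: if_distrib[of "(*) _"] cong: if_cong)
    finally show ?thesis .
  qed
  with sgn b show ?thesis by (auto simp: positive_def uminus_root coord_uminus)
qed

lemma not_positive_uminus: "positive \<beta> \<Longrightarrow> \<not> positive (- \<beta>)"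
proof
  assume p: "positive \<beta>" "positive (- \<beta>)"
  then have "\<beta> \<in> \<Phi>" by (simp add: positive_def)
  have "coord \<beta> \<alpha> = 0" if "\<alpha> \<in> \<Delta>" for \<alpha>
    using p that coord_uminus[OF \<open>\<beta> \<in> \<Phi>\<close>, of \<alpha>] unfolding positive_def by force
  with coord_sum[OF \<open>\<beta> \<in> \<Phi>\<close>] have "\<beta> = 0" by simp
  with zero_notin_roots \<open>\<beta> \<in> \<Phi>\<close> show False by blast
qed

lemma simple_positive: "\<alpha> \<in> \<Delta> \<Longrightarrow> positive \<alpha>"
  using simple_subset
  by (auto simp: positive_def coord_def representation_basis independent_simple)

text \<open>A positive root other than \<alpha> has a positive coordinate at some other simple root,
  since it is not on the line of \<alpha>. Reflecting changes only the coordinate at \<alpha>, so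
  that coordinate survives and decides the sign of the whole root.\<close>

lemma positive_refl:
  assumes a: "\<alpha> \<in> \<Delta>" and b: "positive \<beta>" and ne: "\<beta> \<noteq> \<alpha>"
  shows "positive (refl \<alpha> *v \<beta>)"
proof -
  have aP: "\<alpha> \<in> \<Phi>" and bP: "\<beta> \<in> \<Phi>" using a b simple_subset by (auto simp: positive_def)
  have sP: "refl \<alpha> *v \<beta> \<in> \<Phi>" using refl_in_W[OF aP] roots_invariant bP by blast
  have "\<exists>\<gamma>\<in>\<Delta> - {\<alpha>}. coord \<beta> \<gamma> \<noteq> 0"
  proof (rule ccontr)
    assume "\<not> ?thesis"
    then have "(\<Sum>\<gamma>\<in>\<Delta>. coord \<beta> \<gamma> *\<^sub>R \<gamma>) = coord \<beta> \<alpha> *\<^sub>R \<alpha>"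
      using finite_simple a by (subst sum.remove[of _ \<alpha>]) auto
    then have "\<beta> \<in> span {\<alpha>}" using coord_sum[OF bP] by (metis insertI1 span_base span_scale)
    then have "\<beta> = - \<alpha>" using roots_line[OF aP] bP ne by blast
    then show False using not_positive_uminus[OF simple_positive[OF a]] b by simp
  qed
  then obtain \<gamma> where g: "\<gamma> \<in> \<Delta>" "\<gamma> \<noteq> \<alpha>" "coord \<beta> \<gamma> \<noteq> 0" by blast
  with b have "coord (refl \<alpha> *v \<beta>) \<gamma> > 0"
    by (simp add: coord_refl[OF a bP] positive_def order_less_le)
  then have "\<not> positive (- (refl \<alpha> *v \<beta>))"
    using g(1) coord_uminus[OF sP, of \<gamma>] unfolding positive_def by force
  with positive_cases[OF sP] show ?thesis by blast
qed

text \<open>Applying the letters one after the other leads from the positive \<gamma> to the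
  negative \<delta>. A simple reflection makes only its own root negative, so at some letter the
  current root is the simple root of that letter; conjugated to this place, the reflection cancels
  the letter. What remains is a word in the same set \<open>T\<close>, which is what cosets need
  later.\<close>

lemma exchange:
  assumes "positive \<gamma>" "\<gamma> = word xs *v \<delta>" "positive (- \<delta>)" "set xs \<subseteq> T" "T \<subseteq> refl ` \<Delta>"
  obtains ys where "set ys \<subseteq> T" "length ys < length xs" "refl \<gamma> ** word xs = word ys"
proof -
  have "\<exists>ys. set ys \<subseteq> T \<and> length ys < length xs \<and> refl \<gamma> ** word xs = word ys"
    using assms(1,2,4)
  proof (induction xs arbitrary: \<gamma>)
    case Nil
    then show ?case using assms(3) not_positive_uminus by auto
  next
    case (Cons s xs)
    then obtain \<alpha> where a: "\<alpha> \<in> \<Delta>" and s: "s = refl \<alpha>" using assms(5) by auto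
    have a0: "\<alpha> \<noteq> 0" and aP: "\<alpha> \<in> \<Phi>" using a simple_nonzero simple_subset by auto
    show ?case
    proof (cases "\<gamma> = \<alpha>")
      case True
      then show ?thesis using Cons.prems a0 by (intro exI[of _ xs]) (simp add: s refl_cancel)
    next
      case False
      let ?\<gamma> = "refl \<alpha> *v \<gamma>"
      have "positive ?\<gamma>" using positive_refl[OF a] Cons.prems False by blast
      moreover have "?\<gamma> = word xs *v \<delta>"
        using Cons.prems(2) a0 by (simp add: s matrix_vector_mul_assoc[symmetric] refl_refl_apply)
      ultimately obtain ys where ys: "set ys \<subseteq> T" "length ys < length xs" "refl ?\<gamma> ** word xs = word ys"
        using Cons.IH Cons.prems(3) by auto
      have "refl \<gamma> ** refl \<alpha> = refl \<alpha> ** refl ?\<gamma>"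
        using refl_conj[of "refl \<alpha>" ?\<gamma>] refl_in_W[OF aP] a0 by (simp add: refl_refl_apply)
      then have "refl \<gamma> ** word (s # xs) = word (s # ys)"
        by (simp add: s matrix_mul_assoc ys(3)[symmetric])
      then show ?thesis using ys Cons.prems(3) by (intro exI[of _ "s # ys"]) auto
    qed
  qed
  with that show thesis by blast
qed

lemma simple_involution: "T \<subseteq> refl ` \<Delta> \<Longrightarrow> t \<in> T \<Longrightarrow> t ** t = mat 1"
  using simple_nonzero refl_involution by auto

lemma generate_simple_subset: assumes "T \<subseteq> refl ` \<Delta>" shows "generate GL T \<subseteq> W"
proof -
  have "T \<subseteq> W" using assms refl_in_W simple_subset by auto
  then show ?thesis by (rule group.generate_subgroup_incl[OF group_GL _ subgroup_W])
qed

lemma simple_subset_carrier: assumes "T \<subseteq> refl ` \<Delta>" shows "T \<subseteq> carrier GL"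
  using assms simple_involution[OF assms] by (auto simp: GL_def invertible_def)

lemma subgroup_generate_simple: "T \<subseteq> refl ` \<Delta> \<Longrightarrow> subgroup (generate GL T) GL"
  by (rule group.generate_is_subgroup[OF group_GL simple_subset_carrier])

lemma generate_mult: "g \<in> generate GL T \<Longrightarrow> h \<in> generate GL T \<Longrightarrow> g ** h \<in> generate GL T"
  using generate.eng[of g GL T h] by simp

lemma generate_inverse:
  assumes T: "T \<subseteq> refl ` \<Delta>" and g: "g \<in> generate GL T"
  shows "matrix_inv g \<in> generate GL T"
proof -
  have gW: "g \<in> W" using generate_simple_subset[OF T] g by blast
  have "inv\<^bsub>GL\<^esub> g = matrix_inv g"
    using W_inverse[OF gW] invertible_W[OF gW] W_inverse(1)[OF gW, THEN invertible_W]
    by (intro group.inv_equality[OF group_GL]) (auto simp: GL_def)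
  then show ?thesis using subgroup.m_inv_closed[OF subgroup_generate_simple[OF T] g] by simp
qed

text \<open>A positive root of minimal height among those whose reflection is not a product of simple
  reflections has positive inner product with some simple root, and reflecting in that root would
  lower the height.\<close>

lemma refl_in_generate:
  assumes b: "\<beta> \<in> \<Phi>"
  shows "refl \<beta> \<in> generate GL (refl ` \<Delta>)"
proof (rule ccontr)
  let ?G = "generate GL (refl ` \<Delta>)"
  define height where "height \<beta> = (\<Sum>\<alpha>\<in>\<Delta>. coord \<beta> \<alpha>)" for \<beta>
  define X where "X = {\<beta>. positive \<beta> \<and> refl \<beta> \<notin> ?G}"
  assume "refl \<beta> \<notin> ?G"
  then have "X \<noteq> {}" using positive_cases[OF b] refl_uminus[of \<beta>] by (auto simp: X_def)
  moreover have "finite X" by (rule finite_subset[OF _ finite_roots]) (auto simp: X_def positive_def)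
  ultimately obtain \<gamma> where g: "\<gamma> \<in> X" and min: "\<And>\<delta>. \<delta> \<in> X \<Longrightarrow> height \<gamma> \<le> height \<delta>"
    by (meson arg_min_if_finite(1) arg_min_least)
  have gP: "\<gamma> \<in> \<Phi>" and gpos: "positive \<gamma>" using g by (auto simp: X_def positive_def)
  \<comment> \<open>Otherwise expanding \<gamma> in simple roots, with nonnegative coordinates,
    would make \<open>form \<gamma> \<gamma>\<close> nonpositive.\<close>
  have "\<exists>\<alpha>\<in>\<Delta>. form \<gamma> \<alpha> > 0"
  proof (rule ccontr)
    assume "\<not> ?thesis"
    then have le: "coord \<gamma> \<alpha> * form \<alpha> \<gamma> \<le> 0" if "\<alpha> \<in> \<Delta>" for \<alpha>
      using that gpos by (intro mult_nonneg_nonpos) (auto simp: positive_def form_sym[of \<alpha> \<gamma>] not_less)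
    have lin: "form (\<Sum>\<alpha>\<in>A. coord \<gamma> \<alpha> *\<^sub>R \<alpha>) \<gamma> = (\<Sum>\<alpha>\<in>A. coord \<gamma> \<alpha> * form \<alpha> \<gamma>)" if "finite A" for A
      using that by (induction A) (auto simp: form_linear)
    have "form \<gamma> \<gamma> \<le> 0"
      using lin[OF finite_simple] coord_sum[OF gP] le by (simp add: sum_nonpos)
    moreover have "\<gamma> \<noteq> 0" using gP zero_notin_roots by blast
    ultimately show False using form_pos by force
  qed
  then obtain \<alpha> where a: "\<alpha> \<in> \<Delta>" and pos: "form \<gamma> \<alpha> > 0" by blast
  have aP: "\<alpha> \<in> \<Phi>" and a0: "\<alpha> \<noteq> 0" using a simple_subset simple_nonzero by auto
  have aG: "refl \<alpha> \<in> ?G" using a by (intro generate.incl) auto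
  then have "\<gamma> \<noteq> \<alpha>" using g by (auto simp: X_def)
  then have p: "positive (refl \<alpha> *v \<gamma>)" using positive_refl[OF a gpos] by blast
  have "height (refl \<alpha> *v \<gamma>) = height \<gamma> - 2 * form \<gamma> \<alpha> / form \<alpha> \<alpha>"
    using a finite_simple by (simp add: height_def coord_refl[OF a gP] sum_subtractf)
  also have "\<dots> < height \<gamma>" using pos form_pos[OF a0] by simp
  finally have "refl \<alpha> *v \<gamma> \<notin> X" using min by force
  then have "refl (refl \<alpha> *v \<gamma>) \<in> ?G" using p by (simp add: X_def)
  moreover have "refl (refl \<alpha> *v \<gamma>) ** refl \<alpha> = refl \<alpha> ** refl \<gamma>"
    using refl_conj refl_in_W[OF aP] by blast
  ultimately have "refl \<alpha> ** refl \<gamma> \<in> ?G" using aG generate_mult by metis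
  then have "refl \<alpha> ** (refl \<alpha> ** refl \<gamma>) \<in> ?G" using aG generate_mult by blast
  then show False using g a0 by (simp add: refl_cancel X_def)
qed

lemma W_generated: "W = generate GL (refl ` \<Delta>)"
proof
  show "generate GL (refl ` \<Delta>) \<subseteq> W" by (rule generate_simple_subset) simp
  have "W = generate GL (refl ` \<Phi>)"
    using root_system reflections_of_eq[of \<Phi>] by (simp add: root_system_of_def)
  also have "\<dots> \<subseteq> generate GL (refl ` \<Delta>)"
    using refl_in_generate by (intro group.generate_subgroup_incl[OF group_GL] subgroup_generate_simple) auto
  finally show "W \<subseteq> generate GL (refl ` \<Delta>)" .
qed

lemma W_word:
  assumes "w \<in> W"
  obtains xs :: "(real ^ 'n ^ 'n) list" where "set xs \<subseteq> refl ` \<Delta>" "w = word xs"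
proof -
  have "w \<in> generate GL (refl ` \<Delta>)" using assms W_generated by simp
  then show thesis using generate_involutions[OF simple_involution[OF order_refl]] that by blast
qed

lemma word_in_W: "set xs \<subseteq> refl ` \<Delta> \<Longrightarrow> word xs \<in> W"
  using word_in_generate W_generated by blast

text \<open>A chamber \<open>w\<close> lies on the positive side of the wall of \<open>\<alpha>\<close> iff \<open>w\<inverse>\<alpha>\<close> is a positive root.\<close>

definition side :: "real ^ 'n \<Rightarrow> real ^ 'n ^ 'n \<Rightarrow> bool" where
  "side \<alpha> w \<longleftrightarrow> w \<in> W \<and> positive (matrix_inv w *v \<alpha>)"

lemma inverse_refl_mult:
  assumes a: "\<alpha> \<in> \<Phi>" and w: "w \<in> W"
  shows "matrix_inv (refl \<alpha> ** w) *v \<alpha> = - (matrix_inv w *v \<alpha>)"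
proof -
  have sw: "refl \<alpha> ** w \<in> W" using a w refl_in_W mult_in_W by blast
  have "\<alpha> \<noteq> 0" using a zero_notin_roots by blast
  then have "(refl \<alpha> ** w) *v (- (matrix_inv w *v \<alpha>)) = \<alpha>"
    using w refl_self[of \<alpha>] matrix_vector_mult_scaleR[of "refl \<alpha>" "-1" \<alpha>]
      matrix_vector_mult_scaleR[of w "-1" "matrix_inv w *v \<alpha>"]
    by (simp add: matrix_vector_mul_assoc[symmetric] inverse_vector)
  then show ?thesis using inverse_vector(2)[OF sw] by metis
qed

lemma side_refl:
  assumes a: "\<alpha> \<in> \<Phi>" and w: "w \<in> W"
  shows "side \<alpha> (refl \<alpha> ** w) \<longleftrightarrow> \<not> side \<alpha> w"
proof -
  have sw: "refl \<alpha> ** w \<in> W" using a w refl_in_W mult_in_W by blast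
  have "matrix_inv w *v \<alpha> \<in> \<Phi>" using a w W_inverse roots_invariant by blast
  then show ?thesis
    using positive_cases not_positive_uminus w sw by (auto simp: side_def inverse_refl_mult[OF a w])
qed

text \<open>On the negative side, \<open>word xs\<close> carries the negative root
  \<open>?\<delta>\<close> to the positive root \<alpha>, which is the situation of
  \<open>exchange\<close>.\<close>

lemma not_side_shorten:
  assumes a: "\<alpha> \<in> \<Delta>" and xs: "set xs \<subseteq> refl ` \<Delta>" and neg: "\<not> side \<alpha> (word xs)"
  obtains ys where "set ys \<subseteq> refl ` \<Delta>" "length ys < length xs" "refl \<alpha> ** word xs = word ys"
proof -
  have w: "word xs \<in> W" using xs by (rule word_in_W)
  have aP: "\<alpha> \<in> \<Phi>" using a simple_subset by blast
  let ?\<delta> = "matrix_inv (word xs) *v \<alpha>"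
  have "?\<delta> \<in> \<Phi>" using aP w W_inverse roots_invariant by blast
  then have "positive (- ?\<delta>)" using neg positive_cases w by (auto simp: side_def)
  then show thesis
    using exchange[OF simple_positive[OF a] _ _ xs order_refl, of ?\<delta>] inverse_vector(1)[OF w] that by metis
qed

text \<open>If the chamber were on the positive side, dropping the first letter would cross to the
  negative side, where reflecting in \<alpha> shortens the word; this would restore the element with
  fewer letters.\<close>

lemma minimal_word_side:
  assumes xs: "set (x # xs) \<subseteq> refl ` \<Delta>" and x: "x = refl \<alpha>" "\<alpha> \<in> \<Delta>"
    and min: "\<And>ys. set ys \<subseteq> refl ` \<Delta> \<Longrightarrow> word ys = word (x # xs) \<Longrightarrow> length (x # xs) \<le> length ys"
  shows "\<not> side \<alpha> (word (x # xs))"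
proof
  assume s: "side \<alpha> (word (x # xs))"
  have aP: "\<alpha> \<in> \<Phi>" using x simple_subset by blast
  have "\<not> side \<alpha> (word xs)" using s side_refl[OF aP word_in_W] xs x by auto
  then obtain ys where "set ys \<subseteq> refl ` \<Delta>" "length ys < length xs" "refl \<alpha> ** word xs = word ys"
    using not_side_shorten[OF x(2), of xs] xs by auto
  with min[of ys] x show False by simp
qed

text \<open>The root \<alpha>, pulled back by u, is positive and becomes negative when pulled back
  further by v. Writing v in letters of \<open>T\<close>, the exchange condition puts the reflection
  in the pulled back root, which is the conjugate of \<open>refl \<alpha>\<close> by u, into the
  subgroup generated by \<open>T\<close>.\<close>

lemma coset_crossing:
  assumes T: "T \<subseteq> refl ` \<Delta>" and a: "\<alpha> \<in> \<Phi>" and u: "u \<in> W" and v: "v \<in> generate GL T"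
    and su: "side \<alpha> u" and sv: "\<not> side \<alpha> (u ** v)"
  shows "matrix_inv u ** (refl \<alpha> ** u) \<in> generate GL T"
proof -
  have vW: "v \<in> W" using v generate_simple_subset[OF T] by blast
  have uv: "u ** v \<in> W" using u vW mult_in_W by blast
  let ?\<gamma> = "matrix_inv u *v \<alpha>" and ?\<delta> = "matrix_inv (u ** v) *v \<alpha>"
  obtain xs where xs: "set xs \<subseteq> T" "v = word xs"
    using generate_involutions[OF simple_involution[OF T] v] by blast
  have "?\<delta> \<in> \<Phi>" using a uv W_inverse roots_invariant by blast
  then have neg: "positive (- ?\<delta>)" using sv positive_cases uv by (auto simp: side_def)
  have "u *v (v *v ?\<delta>) = \<alpha>" using inverse_vector(1)[OF uv] by (metis matrix_vector_mul_assoc)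
  then have "?\<gamma> = word xs *v ?\<delta>" using inverse_vector(2)[OF u] xs by metis
  then obtain ys where ys: "set ys \<subseteq> T" "length ys < length xs" "refl ?\<gamma> ** word xs = word ys"
    using exchange[OF _ _ neg xs(1) T] su unfolding side_def by metis
  have "refl ?\<gamma> ** v \<in> generate GL T" using ys xs word_in_generate by metis
  then have "(refl ?\<gamma> ** v) ** matrix_inv v \<in> generate GL T"
    using generate_mult generate_inverse[OF T v] by blast
  then have "refl ?\<gamma> \<in> generate GL T"
    by (simp add: matrix_mul_assoc[symmetric] W_inverse(3)[OF vW])
  moreover have "refl \<alpha> ** u = u ** refl ?\<gamma>"
    using refl_conj[OF u, of ?\<gamma>] by (simp add: inverse_vector(1)[OF u])
  ultimately show ?thesis by (simp add: W_cancel(2)[OF u])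
qed

section \<open>Cosets of subgroups generated by simple reflections\<close>

lemma coset_eq: "w <#\<^bsub>GL\<^esub> G = (**) w ` G"
  by (auto simp: l_coset_def)

lemma refl_coset_eq_iff:
  assumes T: "T \<subseteq> refl ` \<Delta>" and a: "\<alpha> \<in> \<Phi>" and u: "u \<in> W"
  shows "(**) (refl \<alpha>) ` ((**) u ` generate GL T) = (**) u ` generate GL T
    \<longleftrightarrow> matrix_inv u ** (refl \<alpha> ** u) \<in> generate GL T" (is "?l \<longleftrightarrow> ?x \<in> ?G")
proof
  have one: "mat 1 \<in> ?G" using generate.one[of GL T] by simp
  assume ?l
  then have "refl \<alpha> ** (u ** mat 1) \<in> (**) u ` ?G" using one by blast
  then show "?x \<in> ?G" using u by (auto simp: W_cancel)
next
  assume x: "?x \<in> ?G"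
  have ux: "refl \<alpha> ** u = u ** ?x" using u by (simp add: W_cancel)
  have a0: "\<alpha> \<noteq> 0" using a zero_notin_roots by blast
  have sub: "(**) (refl \<alpha>) ` ((**) u ` ?G) \<subseteq> (**) u ` ?G"
  proof clarify
    fix g assume "g \<in> ?G"
    then have "?x ** g \<in> ?G" using x generate_mult by blast
    moreover have "refl \<alpha> ** (u ** g) = u ** (?x ** g)"
      using ux by (metis matrix_mul_assoc)
    ultimately show "refl \<alpha> ** (u ** g) \<in> (**) u ` ?G" by blast
  qed
  have "(**) u ` ?G \<subseteq> (**) (refl \<alpha>) ` ((**) u ` ?G)"
  proof
    fix y assume "y \<in> (**) u ` ?G"
    then have "refl \<alpha> ** y \<in> (**) u ` ?G" using sub by blast
    then have "refl \<alpha> ** (refl \<alpha> ** y) \<in> (**) (refl \<alpha>) ` ((**) u ` ?G)" by blast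
    then show "y \<in> (**) (refl \<alpha>) ` ((**) u ` ?G)" using a0 by (simp add: refl_cancel)
  qed
  with sub show ?l by blast
qed

text \<open>A coset that meets both sides has a representative on the positive side from which
  another element of the coset is reached across the wall. By \<open>coset_crossing\<close> the
  reflection, conjugated by this representative, lies in the subgroup and so stabilises the
  coset.\<close>

lemma coset_trichotomy:
  assumes T: "T \<subseteq> refl ` \<Delta>" and a: "\<alpha> \<in> \<Phi>" and w: "w \<in> W" and C: "C = (**) w ` generate GL T"
  shows "(\<forall>u\<in>C. side \<alpha> u) \<or> (\<forall>u\<in>C. \<not> side \<alpha> u) \<or> (**) (refl \<alpha>) ` C = C"
proof (cases "(\<forall>u\<in>C. side \<alpha> u) \<or> (\<forall>u\<in>C. \<not> side \<alpha> u)")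
  case False
  then obtain g h where g: "g \<in> generate GL T" "side \<alpha> (w ** g)"
    and h: "h \<in> generate GL T" "\<not> side \<alpha> (w ** h)" using C by auto
  have gW: "g \<in> W" using g generate_simple_subset[OF T] by blast
  have "matrix_inv g ** h \<in> generate GL T" using generate_mult generate_inverse[OF T] g h by blast
  moreover have "w ** g ** (matrix_inv g ** h) = w ** h"
    by (simp add: matrix_mul_assoc[symmetric] W_cancel[OF gW])
  ultimately have *: "matrix_inv (w ** g) ** (refl \<alpha> ** (w ** g)) \<in> generate GL T"
    using coset_crossing[OF T a mult_in_W[OF w gW], of "matrix_inv g ** h"] g h by simp
  have "C = (**) (w ** g) ` generate GL T"
  proof (intro equalityI subsetI)
    fix y assume "y \<in> C"
    then obtain k where k: "k \<in> generate GL T" "y = w ** k" using C by blast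
    have "matrix_inv g ** k \<in> generate GL T" using generate_mult generate_inverse[OF T] g k by blast
    moreover have "y = w ** g ** (matrix_inv g ** k)"
      by (simp add: matrix_mul_assoc[symmetric] W_cancel[OF gW] k)
    ultimately show "y \<in> (**) (w ** g) ` generate GL T" by blast
  next
    fix y assume "y \<in> (**) (w ** g) ` generate GL T"
    then show "y \<in> C" using C g generate_mult by (auto simp: matrix_mul_assoc[symmetric])
  qed
  with * show ?thesis using refl_coset_eq_iff[OF T a mult_in_W[OF w gW]] by simp
qed blast

text \<open>Each letter of a word adds a multiple of its own root.\<close>

lemma generate_displacement:
  assumes D: "D \<subseteq> \<Delta>" and g: "g \<in> generate GL (refl ` D)"
  shows "g *v v - v \<in> span D"
proof -
  have *: "refl ` D \<subseteq> refl ` \<Delta>" using D by blast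
  obtain xs where xs: "set xs \<subseteq> refl ` D" "g = word xs"
    using generate_involutions[OF simple_involution[OF *] g] by blast
  have "word xs *v v - v \<in> span D" using xs(1)
  proof (induction xs)
    case Nil
    then show ?case by (simp add: span_zero)
  next
    case (Cons x xs)
    then obtain \<alpha> where a: "\<alpha> \<in> D" "x = refl \<alpha>" by auto
    let ?u = "word xs *v v"
    have "word (x # xs) *v v - v = (?u - v) - (2 * form ?u \<alpha> / form \<alpha> \<alpha>) *\<^sub>R \<alpha>"
      by (simp add: matrix_vector_mul_assoc[symmetric] a refl_apply)
    moreover have "\<dots> \<in> span D"
      using Cons.IH Cons.prems a(1) by (intro span_diff[OF _ span_scale[OF span_base]]) auto
    ultimately show ?case by (simp only:)
  qed
  with xs show ?thesis by simp
qed

text \<open>The reflection in \<open>?\<gamma>\<close> moves \<open>?\<gamma>\<close> by a nonzero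
  multiple of itself. Lying in all subgroups, it would place \<open>?\<gamma>\<close> in the span of
  the simple roots of each \<open>T i\<close>; these sets have no root in common, so independence
  leaves no nonzero coordinate.\<close>

lemma no_common_reflection:
  fixes T :: "'k \<Rightarrow> (real ^ 'n ^ 'n) set"
  assumes T: "\<And>i. T i \<subseteq> refl ` \<Delta>" and int: "(\<Inter>i. T i) = {}" and a: "\<alpha> \<in> \<Phi>" and w: "w \<in> W"
  shows "\<exists>i. matrix_inv w ** (refl \<alpha> ** w) \<notin> generate GL (T i)"
proof (rule ccontr)
  assume "\<not> ?thesis"
  then have all: "matrix_inv w ** (refl \<alpha> ** w) \<in> generate GL (T i)" for i by blast
  let ?\<gamma> = "matrix_inv w *v \<alpha>"
  have gP: "?\<gamma> \<in> \<Phi>" using a w W_inverse roots_invariant by blast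
  have g0: "?\<gamma> \<noteq> 0" using gP zero_notin_roots by metis
  have "refl \<alpha> ** w = w ** refl ?\<gamma>"
    using refl_conj[OF w, of ?\<gamma>] by (simp add: inverse_vector(1)[OF w])
  then have all: "refl ?\<gamma> \<in> generate GL (T i)" for i using all[of i] W_cancel(2)[OF w] by metis
  have span: "?\<gamma> \<in> span {\<alpha> \<in> \<Delta>. refl \<alpha> \<in> T i}" for i
  proof -
    have "T i = refl ` {\<alpha> \<in> \<Delta>. refl \<alpha> \<in> T i}" using T[of i] by auto
    then have "refl ?\<gamma> *v ?\<gamma> - ?\<gamma> \<in> span {\<alpha> \<in> \<Delta>. refl \<alpha> \<in> T i}"
      using generate_displacement[of "{\<alpha> \<in> \<Delta>. refl \<alpha> \<in> T i}" "refl ?\<gamma>" ?\<gamma>] all[of i] by simp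
    \<comment> \<open>The displacement of \<open>?\<gamma>\<close> is -2 times
      \<open>?\<gamma>\<close>.\<close>
    then have "(-1/2) *\<^sub>R (refl ?\<gamma> *v ?\<gamma> - ?\<gamma>) \<in> span {\<alpha> \<in> \<Delta>. refl \<alpha> \<in> T i}"
      by (rule span_scale)
    moreover have "(-1/2) *\<^sub>R (refl ?\<gamma> *v ?\<gamma> - ?\<gamma>) = ?\<gamma>"
      using refl_self[OF g0] by (simp add: algebra_simps flip: scaleR_add_left)
    ultimately show ?thesis by simp
  qed
  have "coord ?\<gamma> \<beta> = 0" if b: "\<beta> \<in> \<Delta>" for \<beta>
  proof -
    obtain i where "refl \<beta> \<notin> T i" using int by blast
    then have "representation {\<alpha> \<in> \<Delta>. refl \<alpha> \<in> T i} ?\<gamma> \<beta> = 0"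
      using representation_ne_zero by blast
    then show ?thesis
      using representation_extend[OF independent_simple span[of i]] by (simp add: coord_def)
  qed
  then show False using coord_sum[OF gP] g0 by simp
qed

end

section \<open>Reflection hypergraphs\<close>

locale reflection_kgraph = reflection_group W \<Phi> \<Delta>
  for W :: "(real ^ 'n ^ 'n) set" and \<Phi> \<Delta> :: "(real ^ 'n) set" +
  fixes T :: "'k::finite \<Rightarrow> (real ^ 'n ^ 'n) set"
  assumes T: "\<And>i. T i \<subseteq> refl ` \<Delta>"
begin

definition H :: "('k, (real ^ 'n ^ 'n) set) kgraph" where
  "H = reflection_hypergraph T W"

definition edge :: "real ^ 'n ^ 'n \<Rightarrow> 'k \<Rightarrow> (real ^ 'n ^ 'n) set" where
  "edge w = (\<lambda>i. (**) w ` generate GL (T i))"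

text \<open>The left side is the positive one. For simple \<alpha> it contains the identity chamber,
  so folding left moves towards that chamber.\<close>

definition left_cosets :: "real ^ 'n \<Rightarrow> (real ^ 'n ^ 'n) set set" where
  "left_cosets \<alpha> = {C. \<forall>u\<in>C. side \<alpha> u}"

abbreviation reflect :: "real ^ 'n \<Rightarrow> (real ^ 'n ^ 'n) set \<Rightarrow> (real ^ 'n ^ 'n) set" where
  "reflect \<alpha> \<equiv> (`) ((**) (refl \<alpha>))"

lemma edges_H: "edges H = edge ` W"
  by (auto simp: H_def reflection_hypergraph_def edge_def coset_eq)

lemma part_H: "part H i = (\<lambda>w. edge w i) ` W"
  by (auto simp: H_def reflection_hypergraph_def edge_def LCOSETS_def l_coset_def GL_def)

lemma finite_H: "finite (edges H)" "finite (vertices H)"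
  using finite_W by (auto simp: edges_H vertices_def part_H)

lemma edge_part_H: "e \<in> edges H \<Longrightarrow> e i \<in> part H i"
  by (auto simp: edges_H part_H)

lemma one_in_generate: "mat 1 \<in> generate GL A"
  using generate.one[of GL A] by simp

lemma in_edge: "w \<in> edge w i"
proof -
  have "w ** mat 1 \<in> (**) w ` generate GL (T i)" using one_in_generate by (rule imageI)
  then show ?thesis by (simp add: edge_def)
qed

lemma reflect_edge: "reflect \<alpha> (edge w i) = edge (refl \<alpha> ** w) i"
  by (simp add: edge_def image_image matrix_mul_assoc)

lemma edge_subset: "w \<in> W \<Longrightarrow> edge w i \<subseteq> W"
  using generate_simple_subset[OF T] mult_in_W by (auto simp: edge_def)

lemma left_coset_side:
  assumes a: "\<alpha> \<in> \<Phi>" and w: "w \<in> W"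
  shows "edge w i \<in> left_cosets \<alpha> \<Longrightarrow> side \<alpha> w"
    and "reflect \<alpha> (edge w i) \<in> left_cosets \<alpha> \<Longrightarrow> \<not> side \<alpha> w"
proof -
  show "edge w i \<in> left_cosets \<alpha> \<Longrightarrow> side \<alpha> w"
    using in_edge unfolding left_cosets_def by blast
  assume "reflect \<alpha> (edge w i) \<in> left_cosets \<alpha>"
  then have "side \<alpha> (refl \<alpha> ** w)" using in_edge unfolding left_cosets_def reflect_edge by blast
  then show "\<not> side \<alpha> w" using side_refl[OF a w] by blast
qed

text \<open>A coset without elements on the positive side has its mirror image entirely on that
  side. So a coset for which neither it nor its image is left meets both sides, and the trichotomy
  applies.\<close>

lemma fixed_coset:
  assumes a: "\<alpha> \<in> \<Phi>" and w: "w \<in> W"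
    and not_left: "edge w i \<notin> left_cosets \<alpha>" "reflect \<alpha> (edge w i) \<notin> left_cosets \<alpha>"
  shows "reflect \<alpha> (edge w i) = edge w i"
proof -
  have "\<exists>u\<in>edge w i. side \<alpha> u"
  proof (rule ccontr)
    assume no: "\<not> ?thesis"
    have "side \<alpha> (refl \<alpha> ** u)" if "u \<in> edge w i" for u
      using side_refl[OF a, of u] edge_subset[OF w] that no by blast
    then have "reflect \<alpha> (edge w i) \<in> left_cosets \<alpha>" unfolding left_cosets_def by blast
    with not_left show False by blast
  qed
  then show ?thesis
    using coset_trichotomy[OF T a w refl, of i] not_left(1) unfolding left_cosets_def edge_def by blast
qed

lemma folded:
  assumes a: "\<alpha> \<in> \<Phi>"
  shows "folded_kgraph H (reflect \<alpha>) (left_cosets \<alpha>)"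
proof
  have aW: "refl \<alpha> \<in> W" and a0: "\<alpha> \<noteq> 0" using refl_in_W[OF a] a zero_notin_roots by auto
  show "finite (vertices H)" "finite (edges H)" by (rule finite_H)+
  show "e i \<in> part H i" if "e \<in> edges H" for e i using that by (rule edge_part_H)
  show "reflect \<alpha> v \<in> part H i" if "v \<in> part H i" for i v
    using that mult_in_W[OF aW] by (auto simp: part_H reflect_edge)
  show "reflect \<alpha> (reflect \<alpha> v) = v" if "v \<in> part H i" for i v
    using a0 by (simp add: image_image refl_cancel)
  show "reflect \<alpha> \<circ> e \<in> edges H" if e: "e \<in> edges H" for e
  proof -
    obtain w where w: "w \<in> W" "e = edge w" using e by (auto simp: edges_H)
    then have "reflect \<alpha> \<circ> e = edge (refl \<alpha> ** w)" by (simp add: fun_eq_iff reflect_edge)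
    then show ?thesis using w mult_in_W[OF aW] by (simp add: edges_H)
  qed
  show "reflect \<alpha> v = v" if "v \<in> part H i" "v \<notin> left_cosets \<alpha>" "reflect \<alpha> v \<notin> left_cosets \<alpha>" for i v
    using that fixed_coset[OF a] by (auto simp: part_H)
  show "reflect \<alpha> v \<notin> left_cosets \<alpha>" if "v \<in> part H i" "v \<in> left_cosets \<alpha>" for i v
    using that left_coset_side[OF a] by (auto simp: part_H)
  show "reflect \<alpha> (e j) \<notin> left_cosets \<alpha>" if "e \<in> edges H" "e i \<in> left_cosets \<alpha>" for e i j
    using that left_coset_side[OF a] by (auto simp: edges_H)
qed

abbreviation fold_pos :: "real ^ 'n \<Rightarrow> ('k \<Rightarrow> (real ^ 'n ^ 'n) set) \<Rightarrow> 'k \<Rightarrow> (real ^ 'n ^ 'n) set" where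
  "fold_pos \<alpha> \<equiv> folded_kgraph.fold_left (reflect \<alpha>) (left_cosets \<alpha>)"

abbreviation fold_neg :: "real ^ 'n \<Rightarrow> ('k \<Rightarrow> (real ^ 'n ^ 'n) set) \<Rightarrow> 'k \<Rightarrow> (real ^ 'n ^ 'n) set" where
  "fold_neg \<alpha> \<equiv> folded_kgraph.fold_right (reflect \<alpha>) (left_cosets \<alpha>)"

text \<open>The delicate case is a chamber on the negative side whose edge has no vertex wholly on
  that side. The fold leaves the edge alone, but all of its cosets are then fixed, so w and its
  mirror image give the same edge.\<close>

lemma fold_pos_edge:
  assumes a: "\<alpha> \<in> \<Phi>" and w: "w \<in> W"
  shows "fold_pos \<alpha> (edge w) = edge (if side \<alpha> w then w else refl \<alpha> ** w)"
proof -
  have eq: "reflect \<alpha> \<circ> edge w = edge (refl \<alpha> ** w)" by (simp add: fun_eq_iff reflect_edge)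
  have "fold_pos \<alpha> (edge w) =
      (if \<exists>i. reflect \<alpha> (edge w i) \<in> left_cosets \<alpha> then reflect \<alpha> \<circ> edge w else edge w)"
    by (rule folded_kgraph.fold_left_def[OF folded[OF a]])
  moreover have "edge (refl \<alpha> ** w) = edge w"
    if "\<not> side \<alpha> w" "\<not> (\<exists>i. reflect \<alpha> (edge w i) \<in> left_cosets \<alpha>)"
  proof
    fix i
    show "edge (refl \<alpha> ** w) i = edge w i"
      using that left_coset_side(1)[OF a w] fixed_coset[OF a w, of i] unfolding reflect_edge by blast
  qed
  ultimately show ?thesis
    using left_coset_side(2)[OF a w] eq by (cases "side \<alpha> w") auto
qed

text \<open>Different elements of \<open>W\<close> may give the same edge, so the minimum runs over
  the words of all of them.\<close>

definition edge_length :: "('k \<Rightarrow> (real ^ 'n ^ 'n) set) \<Rightarrow> nat" where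
  "edge_length e = (LEAST n. \<exists>xs. set xs \<subseteq> refl ` \<Delta> \<and> edge (word xs) = e \<and> n = length xs)"

lemma edge_length_le: "set xs \<subseteq> refl ` \<Delta> \<Longrightarrow> edge_length (edge (word xs)) \<le> length xs"
  unfolding edge_length_def by (rule Least_le) blast

lemma edge_length_word:
  assumes "e \<in> edges H"
  obtains xs where "set xs \<subseteq> refl ` \<Delta>" "e = edge (word xs)" "edge_length e = length xs"
proof -
  obtain w where w: "w \<in> W" "e = edge w" using assms by (auto simp: edges_H)
  obtain ys where "set ys \<subseteq> refl ` \<Delta>" "w = word ys" using W_word[OF w(1)] .
  then have "\<exists>n xs. set xs \<subseteq> refl ` \<Delta> \<and> edge (word xs) = e \<and> n = length xs" using w by blast
  from LeastI_ex[OF this] show thesis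
    using that unfolding edge_length_def by metis
qed

lemma edge_length_fold:
  assumes a: "\<alpha> \<in> \<Delta>" and e: "e \<in> edges H"
  shows "edge_length (fold_pos \<alpha> e) \<le> edge_length e"
proof -
  obtain xs where xs: "set xs \<subseteq> refl ` \<Delta>" "e = edge (word xs)" "edge_length e = length xs"
    using edge_length_word[OF e] .
  have f: "fold_pos \<alpha> e = edge (if side \<alpha> (word xs) then word xs else refl \<alpha> ** word xs)"
    using fold_pos_edge word_in_W[OF xs(1)] a simple_subset xs(2) by blast
  show ?thesis
  proof (cases "side \<alpha> (word xs)")
    case True
    then show ?thesis using f xs(2) by simp
  next
    case False
    then obtain ys where ys: "set ys \<subseteq> refl ` \<Delta>" "length ys < length xs" "refl \<alpha> ** word xs = word ys"
      using not_side_shorten[OF a xs(1)] by blast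
    then show ?thesis using f False edge_length_le[OF ys(1)] xs(3) by simp
  qed
qed

text \<open>Take a shortest word for the edge and the simple root of its first letter: the chamber
  lies on the negative side of that wall, and folding deletes the letter.\<close>

lemma edge_length_decrease:
  assumes e: "e \<in> edges H" and ne: "e \<noteq> edge (mat 1)"
  obtains \<alpha> where "\<alpha> \<in> \<Delta>" "edge_length (fold_pos \<alpha> e) < edge_length e"
proof -
  obtain xs where xs: "set xs \<subseteq> refl ` \<Delta>" "e = edge (word xs)" "edge_length e = length xs"
    using edge_length_word[OF e] .
  then obtain x ys where x: "xs = x # ys" using ne by (cases xs) auto
  then obtain \<alpha> where a: "\<alpha> \<in> \<Delta>" "x = refl \<alpha>" using xs(1) by auto
  have min: "length xs \<le> length zs" if "set zs \<subseteq> refl ` \<Delta>" "word zs = word xs" for zs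
    using edge_length_le[OF that(1)] that(2) xs by simp
  have neg: "\<not> side \<alpha> (word xs)"
    unfolding x by (rule minimal_word_side[OF _ a(2,1)]) (use xs(1) min in \<open>simp_all add: x\<close>)
  have "fold_pos \<alpha> e = edge (refl \<alpha> ** word xs)"
    using fold_pos_edge[of \<alpha> "word xs"] word_in_W[OF xs(1)] a(1) simple_subset xs(2) neg by auto
  also have "refl \<alpha> ** word xs = word ys"
    using simple_nonzero[OF a(1)] by (simp add: x a(2) refl_cancel)
  finally have "edge_length (fold_pos \<alpha> e) \<le> length ys"
    using edge_length_le[of ys] xs(1) x by simp
  then show thesis using a(1) xs(3) x by (intro that[of \<alpha>]) auto
qed

lemma partite: "partite_kgraph H"
proof
  show "edges H \<noteq> {}" using one_in_W by (auto simp: edges_H)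
qed (use finite_H edge_part_H in auto)

lemma color_bounded_H:
  assumes F: "\<F> \<subseteq> bounded_borel" and scale: "\<And>f c. f \<in> \<F> \<Longrightarrow> 0 < c \<Longrightarrow> (\<lambda>x. c * f x) \<in> \<F>"
    and middle: "(\<forall>f\<in>\<F>. \<forall>x. 0 \<le> f x) \<or> (\<Inter>i. T i) = {}"
  shows "partite_kgraph.color_bounded H \<F>"
  unfolding partite_kgraph.color_bounded_def[OF partite]
proof (intro conjI ballI allI impI)
  show "\<F> \<subseteq> bounded_borel" by fact
  show "(\<lambda>x. c * f x) \<in> \<F>" if "f \<in> \<F>" "0 < c" for f c using that by (rule scale)
  fix f g c
  assume fg: "f \<in> \<F>" "g \<in> \<F>" and le: "\<bar>colored_integral H (\<lambda>_. f)\<bar> \<le> 1" "\<bar>colored_integral H (\<lambda>_. g)\<bar> \<le> 1"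
    and c: "c ` edges H \<subseteq> {f, g}"
  \<comment> \<open>Only walls of simple roots are used, since the exchange condition shows that
    folding towards their positive sides never lengthens an edge.\<close>
  let ?Folds = "(\<lambda>\<alpha>. (fold_pos \<alpha>, fold_neg \<alpha>)) ` \<Delta>"
  show "\<bar>colored_integral H c\<bar> \<le> 1"
  proof (rule maximal_coloring_bound[where I = "colored_integral H" and E = "edges H" and C = "{f, g}" and Folds = ?Folds
        and len = edge_length and e\<^sub>0 = "edge (mat 1)"])
    show "edge (mat 1) \<in> edges H" using one_in_W by (simp add: edges_H)
    show "colored_integral H d = colored_integral H d'" if "\<And>e. e \<in> edges H \<Longrightarrow> d e = d' e" for d d'
      using that by (rule colored_integral_cong)
    fix \<phi> \<psi> assume "(\<phi>, \<psi>) \<in> ?Folds"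
    then obtain \<alpha> where a: "\<alpha> \<in> \<Delta>" and f: "\<phi> = fold_pos \<alpha>" "\<psi> = fold_neg \<alpha>" by blast
    then have aP: "\<alpha> \<in> \<Phi>" using simple_subset by blast
    interpret folded_kgraph H "reflect \<alpha>" "left_cosets \<alpha>" by (rule folded[OF aP])
    show "\<phi> ` edges H \<subseteq> edges H \<and> \<psi> ` edges H \<subseteq> edges H"
      using edges_closed by (auto simp: f fold_left_def fold_right_def)
    show "edge_length (\<phi> e) \<le> edge_length e" if "e \<in> edges H" for e
      unfolding f by (rule edge_length_fold[OF a that])
    fix d assume d: "d ` edges H \<subseteq> {f, g}"
    have mid: "(\<forall>e\<in>edges H. \<forall>x. 0 \<le> d e x) \<or> (\<forall>e\<in>edges H. \<exists>i. reflect \<alpha> (e i) \<noteq> e i)"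
      using middle
    proof
      assume "\<forall>f\<in>\<F>. \<forall>x. 0 \<le> f x"
      then show ?thesis using d fg by blast
    next
      \<comment> \<open>An edge fixed in every part would put one and the same conjugate of
        \<open>refl \<alpha>\<close> into all subgroups.\<close>
      assume int: "(\<Inter>i. T i) = {}"
      have "\<exists>i. reflect \<alpha> (edge w i) \<noteq> edge w i" if w: "w \<in> W" for w
      proof -
        obtain i where i: "matrix_inv w ** (refl \<alpha> ** w) \<notin> generate GL (T i)"
          using no_common_reflection[OF T int aP w] by (rule exE)
        have "reflect \<alpha> (edge w i) \<noteq> edge w i"
          unfolding edge_def refl_coset_eq_iff[OF T[of i] aP w] by (rule i)
        then show ?thesis by (rule exI)
      qed
      then show ?thesis by (auto simp: edges_H)
    qed
    have "d e \<in> bounded_borel" if "e \<in> edges H" for e using that d fg F by blast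
    from fold_inequality[OF this mid]
    show "\<bar>colored_integral H d\<bar> \<le> (colored_integral H (\<lambda>e. d (\<phi> e)) + colored_integral H (\<lambda>e. d (\<psi> e))) / 2"
      unfolding f .
  next
    fix e assume "e \<in> edges H" "e \<noteq> edge (mat 1)"
    then obtain \<alpha> where "\<alpha> \<in> \<Delta>" "edge_length (fold_pos \<alpha> e) < edge_length e"
      by (rule edge_length_decrease)
    then show "\<exists>\<phi> \<psi>. (\<phi>, \<psi>) \<in> ?Folds \<and> edge_length (\<phi> e) < edge_length e" by blast
  qed (use finite_H le c in auto)
qed

lemma weakly_norming_H: "weakly_norming H"
  by (rule partite_kgraph.weakly_norming_if_color_bounded[OF partite color_bounded_H])
     (auto intro: bounded_borel_scale)

lemma norming_H: "(\<Inter>i. T i) = {} \<Longrightarrow> norming H"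
  by (rule partite_kgraph.norming_if_color_bounded[OF partite color_bounded_H])
     (auto intro: bounded_borel_scale)

end

theorem theorem5p1:
  fixes W S :: "(real ^ 'n ^ 'n) set"
    and \<Phi> \<Delta> :: "(real ^ 'n) set"
    and T :: "'k::finite \<Rightarrow> (real ^ 'n ^ 'n) set"
  assumes "finite_reflection_group W"
    and "root_system_of W \<Phi>"
    and "simple_system \<Phi> \<Delta>"
    and "S = reflections_of W \<Delta>"
    and "\<And>i. T i \<subseteq> S"
  shows "weakly_norming (reflection_hypergraph T W) \<and>
    ((\<Inter>i. T i) = {} \<longrightarrow> norming (reflection_hypergraph T W))"
proof -
  interpret reflection_group W \<Phi> \<Delta> using assms(1-3) by unfold_locales
  interpret reflection_kgraph W \<Phi> \<Delta> T
    using assms(4,5) reflections_of_eq[OF simple_subset] by unfold_locales blast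
  show ?thesis using weakly_norming_H norming_H by (simp add: H_def)
qed

end
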